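(* Let $k$ be an infinite field, let $0<r<m\le n$ be integers, and let $\Omega=\bigcup_{j\in[n]}\omega_j\times\{j\}\subset[m]\times[n]$ with $\omega_j\subset[m]$. If $\Omega$ is a base set of the algebraic matroid of $\mathrm{M}(r,m\times n)$, then $\Omega$ is a relaxed $(r,r,m)$-SLMF.
   Context: Notation: $[s]=\{1,\dots,s\}$; $\#$ denotes cardinality. $Z=(z_{ij})_{(i,j)\in[m]\times[n]}$ is an $m\times n$ matrix of independent variables over $k$, $k[Z]$ is the polynomial ring in these variables, and $I_{r+1}(Z)$ is the (prime) ideal generated by all $(r+1)\times(r+1)$ minors of $Z$. The determinantal variety is $\mathrm{M}(r,m\times n)=\operatorname{Spec}k[Z]/I_{r+1}(Z)$, an integral scheme of dimension $r(m+n-r)$. Algebraic matroid of $\mathrm{M}(r,m\times n)$: its ground set is $[m]\times[n]$; a subset $\Omega\subset[m]\times[n]$ is independent if the images in $k[Z]/I_{r+1}(Z)$ of the $z_{ij}$ with $(i,j)\in\Omega$ are algebraically independent over $k$. A base (or base set) is a maximal independent set; every base has cardinality $r(m+n-r)$. For $\mathcal{J}\subset[n]$ put $\Omega_{\mathcal{J}}=\bigcup_{j\in\mathcal{J}}\omega_j\times\{j\}$ (so $\Omega=\Omega_{[n]}$). For a positive integer $\nu$, $\Omega_{\mathcal{J}}$ is called a relaxed $(\nu,r,m)$-SLMF if $$\sum_{j\in\mathcal{J}}\max\{\#(\omega_j\cap\mathcal{I})-r,\,0\}\le\nu(\#\mathcal{I}-r)$$ for every $\mathcal{I}\subset[m]$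 with $\#\mathcal{I}\ge r+1$, with equality for $\mathcal{I}=[m]$. *)

theory Defs
  imports
    "HOL-Library.Poly_Mapping"
    "HOL-Algebra.QuotRing"
    "Jordan_Normal_Form.Determinant"
    "Jordan_Normal_Form.DL_Submatrix"
begin

section \<open>Multivariate polynomial rings\<close>

text \<open>
  A polynomial is a finitely supported map from monomials to coefficients, and a monomial is a
  finitely supported map from variables to exponents.
\<close>

type_synonym ('v, 'k) mpoly = "('v \<Rightarrow>\<^sub>0 nat) \<Rightarrow>\<^sub>0 'k"

definition Const :: "'k::zero \<Rightarrow> ('v, 'k) mpoly"
  where "Const c = Poly_Mapping.single 0 c"

definition Var :: "'v \<Rightarrow> ('v, 'k::zero_neq_one) mpoly"
  where "Var x = Poly_Mapping.single (Poly_Mapping.single x 1) 1"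

definition polys :: "'v set \<Rightarrow> ('v, 'k::zero) mpoly set"
  where "polys V = {p. \<forall>t \<in> Poly_Mapping.keys p. Poly_Mapping.keys t \<subseteq> V}"

definition poly_ring :: "'v set \<Rightarrow> ('v, 'k::comm_ring_1) mpoly ring"
  where "poly_ring V =
    \<lparr>carrier = polys V, monoid.mult = (*), one = 1, ring.zero = 0, add = (+)\<rparr>"

section \<open>Algebraic independence\<close>

text \<open>
  Here \<open>A\<close> is a commutative ring viewed as an algebra over the type \<open>'k\<close> through the structure
  map \<open>\<phi>\<close>. Independence is that of the family \<open>a\<close> indexed by \<open>X\<close>: repetitions count.
\<close>

definition eval_alg ::
    "('a, 'c) ring_scheme \<Rightarrow> ('k \<Rightarrow> 'a) \<Rightarrow> ('v \<Rightarrow> 'a) \<Rightarrow> ('v, 'k::zero) mpoly \<Rightarrow> 'a"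
  where "eval_alg A \<phi> a p =
    (\<Oplus>\<^bsub>A\<^esub> t \<in> Poly_Mapping.keys p.
       \<phi> (Poly_Mapping.lookup p t) \<otimes>\<^bsub>A\<^esub>
       (\<Otimes>\<^bsub>A\<^esub> x \<in> Poly_Mapping.keys t. a x [^]\<^bsub>A\<^esub> Poly_Mapping.lookup t x))"

definition algebraically_independent ::
    "('a, 'c) ring_scheme \<Rightarrow> ('k::zero \<Rightarrow> 'a) \<Rightarrow> ('v \<Rightarrow> 'a) \<Rightarrow> 'v set \<Rightarrow> bool"
  where "algebraically_independent A \<phi> a X \<longleftrightarrow>
    (\<forall>p \<in> polys X. eval_alg A \<phi> a p = \<zero>\<^bsub>A\<^esub> \<longrightarrow> p = 0)"

section \<open>The coordinate ring of the determinantal variety and its matroid\<close>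

text \<open>Rows and columns are numbered from \<open>0\<close>: \<open>{..<m}\<close> plays the role of \<open>{1,\<dots>,m}\<close>.\<close>

definition ground :: "nat \<Rightarrow> nat \<Rightarrow> (nat \<times> nat) set"
  where "ground m n = {..<m} \<times> {..<n}"

definition generic_mat :: "nat \<Rightarrow> nat \<Rightarrow> (nat \<times> nat, 'k::comm_ring_1) mpoly mat"
  where "generic_mat m n = mat m n Var"

definition minors :: "nat \<Rightarrow> 'a::comm_ring_1 mat \<Rightarrow> 'a set"
  where "minors s M =
    {det (submatrix M I J) | I J.
       I \<subseteq> {..<dim_row M} \<and> J \<subseteq> {..<dim_col M} \<and> card I = s \<and> card J = s}"

definition det_ideal :: "nat \<Rightarrow> nat \<Rightarrow> nat \<Rightarrow> (nat \<times> nat, 'k::comm_ring_1) mpoly set"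
  where "det_ideal r m n =
    Idl\<^bsub>poly_ring (ground m n)\<^esub> (minors (r + 1) (generic_mat m n))"

definition coord_ring :: "nat \<Rightarrow> nat \<Rightarrow> nat \<Rightarrow> (nat \<times> nat, 'k::comm_ring_1) mpoly set ring"
  where "coord_ring r m n = poly_ring (ground m n) Quot det_ideal r m n"

definition residue_class ::
    "nat \<Rightarrow> nat \<Rightarrow> nat \<Rightarrow> (nat \<times> nat, 'k::comm_ring_1) mpoly \<Rightarrow> (nat \<times> nat, 'k) mpoly set"
  where "residue_class r m n p = det_ideal r m n +>\<^bsub>poly_ring (ground m n)\<^esub> p"

text \<open>
  The \<open>itself\<close> argument records the coefficient field, which cannot be read off the other arguments.
\<close>

definition matroid_indep ::
    "'k::field itself \<Rightarrow> nat \<Rightarrow> nat \<Rightarrow> nat \<Rightarrow> (nat \<times> nat) set \<Rightarrow> bool"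
  where "matroid_indep K r m n \<Omega> \<longleftrightarrow>
    \<Omega> \<subseteq> ground m n \<and>
    algebraically_independent (coord_ring r m n)
      (\<lambda>c :: 'k. residue_class r m n (Const c)) (\<lambda>x. residue_class r m n (Var x)) \<Omega>"

definition matroid_base ::
    "'k::field itself \<Rightarrow> nat \<Rightarrow> nat \<Rightarrow> nat \<Rightarrow> (nat \<times> nat) set \<Rightarrow> bool"
  where "matroid_base K r m n \<Omega> \<longleftrightarrow>
    matroid_indep K r m n \<Omega> \<and>
    (\<forall>\<Omega>'. matroid_indep K r m n \<Omega>' \<and> \<Omega> \<subseteq> \<Omega>' \<longrightarrow> \<Omega>' = \<Omega>)"

section \<open>Relaxed supports of linkage matching fields\<close>

definition Omega :: "(nat \<Rightarrow> nat set) \<Rightarrow> nat set \<Rightarrow> (nat \<times> nat) set"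
  where "Omega \<omega> J = (\<Union>j \<in> J. \<omega> j \<times> {j})"

text \<open>
  The condition is on the set \<open>Omega \<omega> J\<close>, presented by the family \<open>\<omega>\<close> of its columns. The
  differences are taken in the integers so that they do not truncate.
\<close>

definition relaxed_SLMF ::
    "nat \<Rightarrow> nat \<Rightarrow> nat \<Rightarrow> (nat \<Rightarrow> nat set) \<Rightarrow> nat set \<Rightarrow> bool"
  where "relaxed_SLMF \<nu> r m \<omega> J \<longleftrightarrow>
    0 < \<nu> \<and>
    (\<forall>I \<subseteq> {..<m}. card I \<ge> r + 1 \<longrightarrow>
       (\<Sum>j\<in>J. max (int (card (\<omega> j \<inter> I)) - int r) 0) \<le> int \<nu> * (int (card I) - int r)) \<and>
    (\<Sum>j\<in>J. max (int (card (\<omega> j \<inter> {..<m})) - int r) 0) = int \<nu> * (int m - int r)"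

end

theory Submission
  imports Defs "HOL-Library.Function_Algebras"
begin

text \<open>
  Over an infinite field the independent sets of the matroid can be tested on the matrices of rank
  at most \<open>r\<close>, that is, on products of an \<open>m \<times> r\<close> and an \<open>r \<times> n\<close> matrix. For this the ideal of
  minors need not be known to be prime or even radical: by expanding bordered minors, a power of
  every polynomial vanishing on these products lies in the ideal of minors, and this suffices
  because no power of a nonzero polynomial in the variables of an independent set does. The
  vanishing ideal is prime, so the entries of low rank matrices form an algebraic matroid; instead
  of transcendence degrees of fields we compare the growth of spaces of polynomials of bounded
  degree.

  On rows \<open>I\<close> and columns \<open>J\<close> with at least \<open>r\<close> elements each, all entries are algebraic over
  those in \<open>r\<close> fixed rows and \<open>r\<close> fixed columns, so an independent subset of \<open>I \<times> J\<close> has at most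
  \<open>r (#I + #J - r)\<close> elements. Applied to the columns meeting \<open>I\<close> in at least \<open>r\<close> elements this is
  the inequality. Conversely the entries in the first \<open>r\<close> rows and columns are independent, so a
  base has at least \<open>r (m + n - r)\<close> elements, which gives equality for \<open>I = [m]\<close>.
\<close>

section \<open>Evaluation of polynomials\<close>

text \<open>Type class counterpart of \<open>eval_alg\<close>, free of carrier sets. Monomials can
  be evaluated in a field or, as in \<open>vanishing_prime\<close>, in a ring of univariate
  polynomials.\<close>

definition eval_mon :: "('v \<Rightarrow> 'k::comm_ring_1) \<Rightarrow> ('v \<Rightarrow>\<^sub>0 nat) \<Rightarrow> 'k"
  where "eval_mon z t = (\<Prod>x\<in>Poly_Mapping.keys t. z x ^ Poly_Mapping.lookup t x)"

definition eval_mpoly :: "('v \<Rightarrow> 'k::comm_ring_1) \<Rightarrow> ('v, 'k) mpoly \<Rightarrow> 'k"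
  where "eval_mpoly z p =
    (\<Sum>t\<in>Poly_Mapping.keys p. Poly_Mapping.lookup p t * eval_mon z t)"

lemma eval_mon_superset:
  assumes "finite V" "Poly_Mapping.keys t \<subseteq> V"
  shows "eval_mon z t = (\<Prod>x\<in>V. z x ^ Poly_Mapping.lookup t x)"
  unfolding eval_mon_def using assms
  by (intro prod.mono_neutral_left) (auto simp: in_keys_iff)

lemma eval_mon_0 [simp]: "eval_mon z 0 = 1"
  by (simp add: eval_mon_def)

lemma eval_mon_single [simp]: "eval_mon z (Poly_Mapping.single x n) = z x ^ n"
  by (simp add: eval_mon_def)

lemma eval_mon_add: "eval_mon z (s + t) = eval_mon z s * eval_mon z t"
proof -
  let ?V = "Poly_Mapping.keys s \<union> Poly_Mapping.keys t"
  have "eval_mon z (s + t) = (\<Prod>x\<in>?V. z x ^ Poly_Mapping.lookup (s + t) x)"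
    by (rule eval_mon_superset) (auto dest: subsetD[OF keys_add])
  also have "\<dots> = eval_mon z s * eval_mon z t"
    by (simp add: eval_mon_superset[of ?V s] eval_mon_superset[of ?V t] lookup_add power_add
        prod.distrib)
  finally show ?thesis .
qed

lemma eval_mpoly_superset:
  assumes "finite T" "Poly_Mapping.keys p \<subseteq> T"
  shows "eval_mpoly z p = (\<Sum>t\<in>T. Poly_Mapping.lookup p t * eval_mon z t)"
  unfolding eval_mpoly_def using assms
  by (intro sum.mono_neutral_left) (auto simp: in_keys_iff)

lemma eval_mpoly_0 [simp]: "eval_mpoly z 0 = 0"
  by (simp add: eval_mpoly_def)

lemma eval_mpoly_single [simp]: "eval_mpoly z (Poly_Mapping.single t c) = c * eval_mon z t"
  by (simp add: eval_mpoly_def)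

lemma eval_mpoly_Const [simp]: "eval_mpoly z (Const c) = c"
  by (simp add: Const_def)

lemma eval_mpoly_Var [simp]: "eval_mpoly z (Var x) = z x"
  by (simp add: Var_def)

lemma eval_mpoly_1 [simp]: "eval_mpoly z 1 = 1"
  using eval_mpoly_single[of z 0 1] by (simp del: eval_mpoly_single add: single_one)

lemma eval_mpoly_add [simp]: "eval_mpoly z (p + q) = eval_mpoly z p + eval_mpoly z q"
proof -
  let ?T = "Poly_Mapping.keys p \<union> Poly_Mapping.keys q"
  have "eval_mpoly z (p + q) = (\<Sum>t\<in>?T. Poly_Mapping.lookup (p + q) t * eval_mon z t)"
    by (rule eval_mpoly_superset) (auto dest: subsetD[OF keys_add])
  also have "\<dots> = eval_mpoly z p + eval_mpoly z q"
    by (simp add: eval_mpoly_superset[of ?T p] eval_mpoly_superset[of ?T q] lookup_add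
        sum.distrib distrib_right)
  finally show ?thesis .
qed

lemma eval_mpoly_sum [simp]: "eval_mpoly z (sum f A) = (\<Sum>a\<in>A. eval_mpoly z (f a))"
  by (induction A rule: infinite_finite_induct) auto

lemma mpoly_sum_singles:
  "p = (\<Sum>t\<in>Poly_Mapping.keys p. Poly_Mapping.single t (Poly_Mapping.lookup p t))"
  by (rule poly_mapping_eqI)
    (auto simp: lookup_sum lookup_single when_def in_keys_iff sum.delta)

lemma eval_mpoly_mult [simp]: "eval_mpoly z (p * q) = eval_mpoly z p * eval_mpoly z q"
proof -
  let ?s = "\<lambda>p t. Poly_Mapping.single t (Poly_Mapping.lookup p t)"
  have "p * q = (\<Sum>s\<in>Poly_Mapping.keys p. \<Sum>t\<in>Poly_Mapping.keys q. ?s p s * ?s q t)"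
    by (subst mpoly_sum_singles[of p], subst mpoly_sum_singles[of q]) (rule sum_product)
  also have "eval_mpoly z \<dots> = (\<Sum>s\<in>Poly_Mapping.keys p. \<Sum>t\<in>Poly_Mapping.keys q.
      (Poly_Mapping.lookup p s * eval_mon z s) * (Poly_Mapping.lookup q t * eval_mon z t))"
    by (simp add: mult_single eval_mon_add mult_ac)
  also have "\<dots> = eval_mpoly z p * eval_mpoly z q"
    unfolding eval_mpoly_def by (rule sum_product[symmetric])
  finally show ?thesis .
qed

lemma eval_mpoly_power [simp]: "eval_mpoly z (p ^ n) = eval_mpoly z p ^ n"
  by (induction n) auto

lemma eval_mpoly_prod [simp]: "eval_mpoly z (prod f A) = (\<Prod>a\<in>A. eval_mpoly z (f a))"
  by (induction A rule: infinite_finite_induct) auto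

lemma eval_mpoly_uminus [simp]: "eval_mpoly z (- p) = - eval_mpoly z p"
  using eval_mpoly_add[of z p "- p"]
    by (simp del: eval_mpoly_add add: eq_neg_iff_add_eq_0 add.commute)

lemma eval_mpoly_diff [simp]: "eval_mpoly z (p - q) = eval_mpoly z p - eval_mpoly z q"
  using eval_mpoly_add[of z p "- q"] by simp

lemma comm_ring_hom_eval_mpoly: "comm_ring_hom (eval_mpoly z)"
  by unfold_locales auto

lemma eval_mon_cong:
  assumes "\<And>x. x \<in> Poly_Mapping.keys t \<Longrightarrow> z x = z' x"
  shows "eval_mon z t = eval_mon z' t"
  using assms by (simp add: eval_mon_def)

lemma eval_mpoly_cong:
  assumes "p \<in> polys V" "\<And>x. x \<in> V \<Longrightarrow> z x = z' x"
  shows "eval_mpoly z p = eval_mpoly z' p"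
  unfolding eval_mpoly_def using assms
  by (intro sum.cong arg_cong2[of _ _ _ _ "(*)"] eval_mon_cong) (auto simp: polys_def)

lemma eval_mon_scale:
  "eval_mon (\<lambda>x. c * z x) t = c ^ (\<Sum>x\<in>Poly_Mapping.keys t. Poly_Mapping.lookup t x) * eval_mon z t"
  by (simp add: eval_mon_def power_mult_distrib prod.distrib power_sum)

lemma Var_power:
  "Var x ^ n = (Poly_Mapping.single (Poly_Mapping.single x n) 1 :: ('v, 'k::comm_semiring_1) mpoly)"
  by (induction n) (auto simp: Var_def mult_single single_add[symmetric])

lemma single_eq_Const_prod:
  "Poly_Mapping.single t c = Const c * (\<Prod>x\<in>Poly_Mapping.keys t. Var x ^ Poly_Mapping.lookup t x)"
proof -
  have prod: "(\<Prod>x\<in>A. Poly_Mapping.single (f x) 1) =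
      (Poly_Mapping.single (sum f A) 1 :: ('a, 'b) mpoly)"
    if "finite A" for f and A :: "'a set"
    using that by induction (auto simp: mult_single)
  \<comment> \<open>An exponent vector is itself a finitely supported map, so the decomposition of
    polynomials into monomials applies to it as well.\<close>
  have "(\<Sum>x\<in>Poly_Mapping.keys t. Poly_Mapping.single x (Poly_Mapping.lookup t x)) = t"
    by (rule mpoly_sum_singles[symmetric])
  thus ?thesis
    by (simp add: Var_power prod Const_def mult_single)
qed

section \<open>The subring of polynomials in given variables\<close>

lemma polys_mono: "V \<subseteq> W \<Longrightarrow> polys V \<subseteq> polys W"
  by (auto simp: polys_def)

lemma polys_0 [simp]: "0 \<in> polys V"
  by (simp add: polys_def)

lemma polys_1 [simp]: "1 \<in> polys V"
  by (simp add: polys_def)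

lemma polys_Const [simp]: "Const c \<in> polys V"
  by (simp add: polys_def Const_def)

lemma polys_Var [simp]: "(Var x :: ('v, 'k::zero_neq_one) mpoly) \<in> polys V \<longleftrightarrow> x \<in> V"
  by (simp add: polys_def Var_def)

lemma polys_add: "p \<in> polys V \<Longrightarrow> q \<in> polys V \<Longrightarrow> p + q \<in> polys V"
  using keys_add[of p q] by (auto simp: polys_def)

lemma polys_uminus: "(p :: ('v, 'k::comm_ring_1) mpoly) \<in> polys V \<Longrightarrow> - p \<in> polys V"
  by (auto simp: polys_def in_keys_iff)

lemma polys_mult:
  assumes "(p :: ('v, 'k::comm_ring_1) mpoly) \<in> polys V" "q \<in> polys V"
  shows "p * q \<in> polys V"
  unfolding polys_def
proof (safe)
  fix t x assume t: "t \<in> Poly_Mapping.keys (p * q)" "x \<in> Poly_Mapping.keys t"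
  then obtain a b where "t = a + b" "a \<in> Poly_Mapping.keys p" "b \<in> Poly_Mapping.keys q"
    using keys_mult[of p q] by blast
  thus "x \<in> V" using t(2) assms subsetD[OF keys_add[of a b], of x] by (auto simp: polys_def)
qed

lemma polys_power: "(p :: ('v, 'k::comm_ring_1) mpoly) \<in> polys V \<Longrightarrow> p ^ n \<in> polys V"
  by (induction n) (auto intro: polys_mult)

lemma polys_sum: "(\<And>a. a \<in> A \<Longrightarrow> f a \<in> polys V) \<Longrightarrow> sum f A \<in> polys V"
  by (induction A rule: infinite_finite_induct) (auto intro: polys_add)

lemma polys_prod:
  "(\<And>a. a \<in> A \<Longrightarrow> (f a :: ('v, 'k::comm_ring_1) mpoly) \<in> polys V) \<Longrightarrow> prod f A \<in> polys V"
  by (induction A rule: infinite_finite_induct) (auto intro: polys_mult)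

lemma polys_det:
  assumes "\<And>i j. i < s \<Longrightarrow> j < s \<Longrightarrow> F i j \<in> polys V"
  shows "det (mat s s (\<lambda>(i, j). F i j :: ('v, 'k::comm_ring_1) mpoly)) \<in> polys V"
proof -
  have sg: "signof \<pi> * q \<in> polys V" if "(q :: ('v, 'k) mpoly) \<in> polys V" for q \<pi>
    using that polys_uminus[of q V] by (simp add: sign_def)
  show ?thesis
    unfolding det_def using assms
    by (auto intro!: polys_sum sg polys_prod simp: permutes_in_image)
qed

lemma polys_of_nat: "(of_nat c :: ('v, 'k::comm_ring_1) mpoly) \<in> polys V"
  by (induction c) (auto intro: polys_add)

text \<open>Grouping the monomials by their exponent of \<open>x\<close> gives the coefficients.
  With \<open>d\<close> the largest such exponent the leading one is nonzero: monomials with the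
  same exponent of \<open>x\<close> stay distinct once \<open>x\<close> is removed, so nothing
  cancels.\<close>

lemma polys_insert_expansion:
  fixes p :: "('v, 'k::comm_ring_1) mpoly"
  assumes "p \<in> polys (insert x V)" "p \<noteq> 0"
  shows "\<exists>q d. (\<forall>e. q e \<in> polys V) \<and> q d \<noteq> 0 \<and> p = (\<Sum>e\<le>d. q e * Var x ^ e)"
proof -
  let ?deg = "\<lambda>t. Poly_Mapping.lookup t x"
  define r where "r t = t - Poly_Mapping.single x (?deg t)" for t :: "'v \<Rightarrow>\<^sub>0 nat"
  have r: "t = r t + Poly_Mapping.single x (?deg t)" for t
    by (rule poly_mapping_eqI) (auto simp: r_def lookup_add lookup_minus lookup_single when_def)
  define q where "q e = (\<Sum>t\<in>{t\<in>Poly_Mapping.keys p. ?deg t = e}.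
    Poly_Mapping.single (r t) (Poly_Mapping.lookup p t))" for e
  define d where "d = Max (?deg ` Poly_Mapping.keys p)"
  have ne: "Poly_Mapping.keys p \<noteq> {}" using assms(2) by simp
  have "q e \<in> polys V" for e
    unfolding q_def
  proof (intro polys_sum)
    fix t assume "t \<in> {t\<in>Poly_Mapping.keys p. ?deg t = e}"
    hence "Poly_Mapping.keys t \<subseteq> insert x V" using assms(1) by (auto simp: polys_def)
    moreover have "y \<in> Poly_Mapping.keys t \<and> y \<noteq> x" if "y \<in> Poly_Mapping.keys (r t)" for y
      using that
        by (auto simp: r_def in_keys_iff lookup_minus lookup_single when_def split: if_splits)
    ultimately have "Poly_Mapping.keys (r t) \<subseteq> V" by blast
    thus "Poly_Mapping.single (r t) (Poly_Mapping.lookup p t) \<in> polys V" by (auto simp: polys_def)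
  qed
  moreover have "q d \<noteq> 0"
  proof
    assume "q d = 0"
    have "d \<in> ?deg ` Poly_Mapping.keys p" unfolding d_def using ne by (intro Max_in) auto
    then obtain t where t: "t \<in> Poly_Mapping.keys p" "?deg t = d" by auto
    have eq: "r s = r t \<longleftrightarrow> s = t" if "?deg s = d" for s
      using r[of s] r[of t] that t(2) by metis
    have "0 = Poly_Mapping.lookup (q d) (r t)" using \<open>q d = 0\<close> by simp
    also have "\<dots> =
        (\<Sum>s\<in>{s\<in>Poly_Mapping.keys p. ?deg s = d}. if s = t then Poly_Mapping.lookup p s else 0)"
      unfolding q_def lookup_sum by (intro sum.cong) (auto simp: lookup_single when_def eq)
    also have "\<dots> = Poly_Mapping.lookup p t" using t by simp
    finally show False using t(1) by (simp add: in_keys_iff)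
  qed
  moreover have "p = (\<Sum>e\<le>d. q e * Var x ^ e)"
  proof -
    have "(\<Sum>e\<le>d. q e * Var x ^ e) = (\<Sum>e\<le>d. \<Sum>t\<in>{t\<in>Poly_Mapping.keys p. ?deg t = e}.
        Poly_Mapping.single t (Poly_Mapping.lookup p t))"
      by (intro sum.cong refl) (auto simp: q_def sum_distrib_right Var_power mult_single r[symmetric]
        intro!: sum.cong)
    also have "\<dots> = (\<Sum>t\<in>Poly_Mapping.keys p. Poly_Mapping.single t (Poly_Mapping.lookup p t))"
      by (rule sum.group) (auto simp: d_def)
    finally show ?thesis using mpoly_sum_singles[of p] by simp
  qed
  ultimately show ?thesis by blast
qed

section \<open>Polynomials over an infinite field as functions\<close>

lemma poly_eq_0_of_infinite:
  assumes "infinite (UNIV :: 'k::field set)" "\<And>a. poly (q :: 'k poly) a = 0"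
  shows "q = 0"
  using poly_roots_finite[of q] assms by auto

text \<open>Fixing all variables but one leaves a univariate polynomial that vanishes everywhere, so
  its coefficients vanish. The exponents are plain functions that only have to be separated by their
  values on \<open>V\<close>; the induction can then shrink \<open>V\<close> and leave them
  unchanged.\<close>

lemma monomials_independent:
  assumes inf: "infinite (UNIV :: 'k::field set)"
    and "finite V" "finite M"
    and "\<And>s t. s \<in> M \<Longrightarrow> t \<in> M \<Longrightarrow> (\<forall>x\<in>V. s x = (t x :: nat)) \<Longrightarrow> s = t"
    and "\<And>z. (\<Sum>t\<in>M. c t * (\<Prod>x\<in>V. (z x :: 'k) ^ t x)) = 0"
    and "t \<in> M"
  shows "c t = 0"
  using assms(2-)
proof (induction V arbitrary: M t)
  case empty
  then have "M = {t}" by auto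
  with empty show ?case by simp
next
  case (insert v V M t0)
  \<comment> \<open>Exponents in \<open>N\<close> agree at \<open>v\<close>, so the smaller
    \<open>V\<close> still separates them.\<close>
  define N where "N = {t\<in>M. t v = t0 v}"
  show ?case
  proof (rule insert.IH[of N])
    show "finite N" "t0 \<in> N" using insert by (auto simp: N_def)
    show "s = t" if "s \<in> N" "t \<in> N" "\<forall>x\<in>V. s x = t x" for s t
      using that insert.prems(2) by (auto simp: N_def)
    fix z :: "_ \<Rightarrow> 'k"
    define q where "q = (\<Sum>t\<in>M. monom (c t * (\<Prod>x\<in>V. z x ^ t x)) (t v))"
    have "poly q a = 0" for a
    proof -
      have "(\<Prod>x\<in>V. (z(v := a)) x ^ t x) = (\<Prod>x\<in>V. z x ^ t x)" for t :: "_ \<Rightarrow> nat"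
        using insert.hyps by (intro prod.cong) auto
      thus ?thesis
        using insert.prems(3)[of "z(v := a)"] insert.hyps
        by (simp add: q_def poly_sum poly_monom mult_ac del: fun_upd_apply) (simp add: mult_ac)
    qed
    hence "q = 0" by (intro poly_eq_0_of_infinite[OF inf])
    hence "0 = coeff q (t0 v)" by simp
    also have "\<dots> = (\<Sum>t\<in>M. if t v = t0 v then c t * (\<Prod>x\<in>V. z x ^ t x) else 0)"
      by (simp add: q_def coeff_sum)
    also have "\<dots> = (\<Sum>t\<in>N. c t * (\<Prod>x\<in>V. z x ^ t x))"
      unfolding N_def by (rule sum.inter_filter[symmetric]) (rule insert.prems(1))
    finally show "(\<Sum>t\<in>N. c t * (\<Prod>x\<in>V. z x ^ t x)) = 0" ..
  qed
qed

lemma mpoly_eq_0_of_infinite: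
  fixes p :: "('v, 'k::field) mpoly"
  assumes inf: "infinite (UNIV :: 'k set)" and z: "\<And>z. eval_mpoly z p = 0"
  shows "p = 0"
proof (rule ccontr)
  assume "p \<noteq> 0"
  then obtain t where t: "t \<in> Poly_Mapping.keys p" by (meson all_not_in_conv keys_eq_empty)
  define V where "V = (\<Union>t\<in>Poly_Mapping.keys p. Poly_Mapping.keys t)"
  have V: "finite V" "\<And>t. t \<in> Poly_Mapping.keys p \<Longrightarrow> Poly_Mapping.keys t \<subseteq> V"
    by (auto simp: V_def)
  have inj: "inj_on Poly_Mapping.lookup A" for A :: "('v \<Rightarrow>\<^sub>0 nat) set"
    by (rule inj_onI) (simp add: lookup_inject)
  \<comment> \<open>\<open>Abs_poly_mapping\<close> undoes \<open>lookup\<close>, which makes the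
    coefficients of \<open>p\<close> a function of plain exponent functions.\<close>
  have "Poly_Mapping.lookup p (Abs_poly_mapping (Poly_Mapping.lookup t)) = 0"
  proof (rule monomials_independent[OF inf V(1),
        of "Poly_Mapping.lookup ` Poly_Mapping.keys p" "\<lambda>s. Poly_Mapping.lookup p (Abs_poly_mapping s)"])
    fix s t
    assume st: "s \<in> Poly_Mapping.lookup ` Poly_Mapping.keys p"
      "t \<in> Poly_Mapping.lookup ` Poly_Mapping.keys p" "\<forall>x\<in>V. s x = t x"
    have zero: "r x = 0"
      if r: "r \<in> Poly_Mapping.lookup ` Poly_Mapping.keys p" and x: "x \<notin> V" for r x
    proof -
      obtain a where a: "a \<in> Poly_Mapping.keys p" "r = Poly_Mapping.lookup a" using r by auto
      have "x \<notin> Poly_Mapping.keys a" using V(2)[OF a(1)] x by auto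
      thus ?thesis by (simp add: a(2) in_keys_iff)
    qed
    show "s = t"
    proof
      fix x show "s x = t x" using st(3) zero[OF st(1)] zero[OF st(2)] by (cases "x \<in> V") auto
    qed
  next
    fix z :: "'v \<Rightarrow> 'k"
    show "(\<Sum>s\<in>Poly_Mapping.lookup ` Poly_Mapping.keys p.
        Poly_Mapping.lookup p (Abs_poly_mapping s) * (\<Prod>x\<in>V. z x ^ s x)) = 0"
      using z[of z] by (simp add: sum.reindex[OF inj] eval_mpoly_def eval_mon_superset[OF V])
  qed (use t in auto)
  thus False using t by (simp add: in_keys_iff)
qed

text \<open>
  Restricting to a curve through a point where \<open>p\<close> does not vanish and one where \<open>q\<close> does not vanish
  reduces the claim to univariate polynomials.
\<close>

lemma vanishing_prime:
  fixes g :: "'p \<Rightarrow> 'v \<Rightarrow> 'k::field"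
  assumes inf: "infinite (UNIV :: 'k set)"
    and curve: "\<And>u w. \<exists>\<gamma> Q. \<gamma> 0 = u \<and> \<gamma> 1 = w \<and> (\<forall>a x. g (\<gamma> a) x = poly (Q x) a)"
    and pq: "\<And>w. eval_mpoly (g w) p * eval_mpoly (g w) q = 0"
  shows "(\<forall>w. eval_mpoly (g w) p = 0) \<or> (\<forall>w. eval_mpoly (g w) q = 0)"
proof (rule ccontr)
  assume "\<not> ?thesis"
  then obtain u w where uw: "eval_mpoly (g u) p \<noteq> 0" "eval_mpoly (g w) q \<noteq> 0" by auto
  obtain \<gamma> Q where \<gamma>: "\<gamma> 0 = u" "\<gamma> (1::'k) = w" "\<And>a x. g (\<gamma> a) x = poly (Q x) a"
    using curve by metis
  \<comment> \<open>Substitutes the coordinate polynomials of the curve into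
    \<open>p\<close>.\<close>
  define R where "R p = (\<Sum>t\<in>Poly_Mapping.keys p. smult (Poly_Mapping.lookup p t) (eval_mon Q t))"
    for p :: "('v, 'k) mpoly"
  have R: "poly (R p) a = eval_mpoly (g (\<gamma> a)) p" for p a
    by (simp add: R_def poly_sum eval_mon_def poly_prod eval_mpoly_def \<gamma>(3))
  have "R p * R q = 0"
    by (rule poly_eq_0_of_infinite[OF inf]) (simp add: R pq)
  hence "R p = 0 \<or> R q = 0" by simp
  thus False using R[of p 0] R[of q 1] uw \<gamma> by auto
qed

section \<open>A dimension count for algebraically dependent families\<close>

text \<open>Each exponent is bounded separately instead of the total degree: the admissible exponent
  vectors then form a box, whose size is a product.\<close>

definition exps_le :: "('v \<Rightarrow> nat) \<Rightarrow> ('v, 'k::zero) mpoly \<Rightarrow> bool"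
  where "exps_le b p \<longleftrightarrow> (\<forall>t\<in>Poly_Mapping.keys p. \<forall>x. Poly_Mapping.lookup t x \<le> b x)"

lemma exps_le_mono: "exps_le b p \<Longrightarrow> (\<And>x. b x \<le> b' x) \<Longrightarrow> exps_le b' p"
  unfolding exps_le_def by (meson le_trans)

lemma exps_le_0 [simp]: "exps_le b 0"
  by (simp add: exps_le_def)

lemma exps_le_1 [simp]: "exps_le b 1"
  by (simp add: exps_le_def)

lemma exps_le_single: "(\<And>x. Poly_Mapping.lookup t x \<le> b x) \<Longrightarrow> exps_le b (Poly_Mapping.single t c)"
  by (simp add: exps_le_def)

lemma exps_le_add: "exps_le b p \<Longrightarrow> exps_le b q \<Longrightarrow> exps_le b (p + q)"
  using keys_add[of p q] by (auto simp: exps_le_def)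

lemma exps_le_sum: "(\<And>a. a \<in> A \<Longrightarrow> exps_le b (f a)) \<Longrightarrow> exps_le b (sum f A)"
  by (induction A rule: infinite_finite_induct) (auto intro: exps_le_add)

lemma exps_le_mult:
  assumes "exps_le b (p :: ('v, 'k::comm_ring_1) mpoly)" "exps_le c q"
  shows "exps_le (\<lambda>x. b x + c x) (p * q)"
  unfolding exps_le_def
proof (intro ballI allI)
  fix t x assume "t \<in> Poly_Mapping.keys (p * q)"
  then obtain r s where "t = r + s" "r \<in> Poly_Mapping.keys p" "s \<in> Poly_Mapping.keys q"
    using keys_mult[of p q] by blast
  thus "Poly_Mapping.lookup t x \<le> b x + c x"
    using assms by (auto simp: exps_le_def lookup_add intro: add_mono)
qed

lemma exps_le_finite_subset_polys:
  assumes "finite P" "P \<subseteq> polys B"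
  shows "\<exists>C. \<forall>p\<in>P. exps_le (\<lambda>x. if x \<in> B then C else 0) p"
  using assms
proof (induction P)
  case (insert p P)
  then obtain C where C: "\<forall>p\<in>P. exps_le (\<lambda>x. if x \<in> B then C else 0) p" by auto
  define L where "L = (\<Union>t\<in>Poly_Mapping.keys p. Poly_Mapping.lookup t ` Poly_Mapping.keys t)"
  have "finite L" by (auto simp: L_def)
  \<comment> \<open>The inserted 0 keeps \<open>Max\<close> meaningful when \<open>L\<close> is
    empty, that is, when \<open>p\<close> is constant.\<close>
  have p: "exps_le (\<lambda>x. if x \<in> B then Max (insert 0 L) else 0) p"
    unfolding exps_le_def
  proof (intro ballI allI)
    fix t x assume t: "t \<in> Poly_Mapping.keys p"
    show "Poly_Mapping.lookup t x \<le> (if x \<in> B then Max (insert 0 L) else 0)"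
    proof (cases "x \<in> Poly_Mapping.keys t")
      case True
      hence "x \<in> B" using t insert.prems by (auto simp: polys_def)
      moreover have "Poly_Mapping.lookup t x \<in> L" using True t by (auto simp: L_def)
      ultimately show ?thesis using \<open>finite L\<close> by (auto intro: Max_ge)
    qed (simp add: in_keys_iff)
  qed
  show ?case
    by (rule exI[of _ "max C (Max (insert 0 L))"])
      (use C in \<open>auto intro!: exps_le_mono[OF p] intro: exps_le_mono\<close>)
qed auto

section \<open>Counting exponent vectors and comparing growth rates\<close>

lemma card_exponent_box:
  fixes b :: "'v \<Rightarrow> nat"
  assumes "finite V" "\<And>x. x \<notin> V \<Longrightarrow> b x = 0"
  shows "finite {t. \<forall>x. Poly_Mapping.lookup t x \<le> b x}" (is "finite ?T")
    and "card {t. \<forall>x. Poly_Mapping.lookup t x \<le> b x} = (\<Prod>x\<in>V. b x + 1)"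
proof -
  let ?r = "\<lambda>t. restrict (Poly_Mapping.lookup t) V"
  have "bij_betw ?r ?T (PiE V (\<lambda>x. {..b x}))"
  proof (rule bij_betwI')
    fix s t assume st: "s \<in> ?T" "t \<in> ?T"
    show "?r s = ?r t \<longleftrightarrow> s = t"
    proof
      assume *: "?r s = ?r t"
      show "s = t"
      proof (rule poly_mapping_eqI)
        fix x
        show "Poly_Mapping.lookup s x = Poly_Mapping.lookup t x"
        proof (cases "x \<in> V")
          case True
          thus ?thesis using fun_cong[OF *, of x] by simp
        next
          case False
          thus ?thesis using st assms(2)[of x]
            by (metis (mono_tags, lifting) le_zero_eq mem_Collect_eq)
        qed
      qed
    qed simp
  next
    fix t assume "t \<in> ?T"
    thus "?r t \<in> PiE V (\<lambda>x. {..b x})" by auto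
  next
    fix f assume f: "f \<in> PiE V (\<lambda>x. {..b x})"
    let ?f = "\<lambda>x. if x \<in> V then f x else 0"
    have "finite {x. ?f x \<noteq> 0}"
      by (rule finite_subset[OF _ assms(1)]) auto
    hence l: "Poly_Mapping.lookup (Abs_poly_mapping ?f) = ?f" by simp
    have "Abs_poly_mapping ?f \<in> ?T" using f by (auto simp: l)
    moreover have "f = ?r (Abs_poly_mapping ?f)" using f by (auto simp: l PiE_iff extensional_def)
    ultimately show "\<exists>t\<in>?T. f = ?r t" by blast
  qed
  moreover have "finite (PiE V (\<lambda>x. {..b x}))" using assms(1) by (intro finite_PiE) auto
  ultimately show "finite ?T" "card ?T = (\<Prod>x\<in>V. b x + 1)"
    using assms(1) by (auto simp: bij_betw_finite card_PiE dest: bij_betw_same_card)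
qed

lemma power_bounded_exponent_le:
  fixes s m C D :: nat
  assumes "\<And>N. (N + 1) ^ s \<le> (s * N * C + 1) ^ m * D"
  shows "s \<le> m"
proof (rule ccontr)
  assume "\<not> s \<le> m"
  \<comment> \<open>Bounding \<open>s * N * C + 1\<close> by \<open>(s * C + 1) * (N + 1)\<close>
    makes this \<open>N\<close> the constant factor on the right. For \<open>s > m\<close>,
    cancelling \<open>(N + 1) ^ m\<close> then gives \<open>N + 1 \<le> N\<close>.\<close>
  define N where "N = (s * C + 1) ^ m * D"
  have "(N + 1) ^ m * (N + 1) \<le> (N + 1) ^ s"
    using \<open>\<not> s \<le> m\<close> power_increasing[of "Suc m" s "N + 1"] by (simp add: mult.commute)
  also have "\<dots> \<le> (s * N * C + 1) ^ m * D" by (rule assms)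
  also have "\<dots> \<le> ((s * C + 1) * (N + 1)) ^ m * D"
    by (intro mult_right_mono power_mono) (auto simp: algebra_simps)
  also have "\<dots> = (N + 1) ^ m * ((s * C + 1) ^ m * D)"
    by (simp only: power_mult_distrib mult_ac)
  also have "\<dots> = (N + 1) ^ m * N" by (simp only: N_def)
  finally show False by simp
qed

lemma sum_apply: "sum f A x = (\<Sum>a\<in>A. f a x)"
  for f :: "'a \<Rightarrow> 'b \<Rightarrow> 'c::comm_monoid_add"
  by (induction A rule: infinite_finite_induct) auto

text \<open>
  The relation \<open>rel\<close> makes the variables in \<open>E\<close> algebraic over those in \<open>B\<close> on the points \<open>g w\<close>.
  Rewriting with it, every monomial of degree at most \<open>k\<close>, multiplied by \<open>a ^ k\<close>, becomes a
  combination of monomials whose exponents are linear in \<open>k\<close> on \<open>B\<close> and bounded on \<open>E\<close>. The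
  number of these grows like \<open>k ^ card B\<close>.
\<close>

lemma independent_card_le:
  fixes g :: "'p \<Rightarrow> 'v \<Rightarrow> 'k::field"
  assumes prime: "\<And>p q. (\<And>w. eval_mpoly (g w) p * eval_mpoly (g w) q = 0) \<Longrightarrow>
      (\<forall>w. eval_mpoly (g w) p = 0) \<or> (\<forall>w. eval_mpoly (g w) q = 0)"
    and fin: "finite B" "finite E" and BE: "B \<inter> E = {}"
    and a: "a \<in> polys B" "eval_mpoly (g w0) a \<noteq> 0"
    and rel: "\<And>y. y \<in> E \<Longrightarrow> \<exists>c. (\<forall>e. c e \<in> polys B) \<and>
      (\<forall>w. eval_mpoly (g w) a * g w y ^ Suc d = (\<Sum>e\<le>d. eval_mpoly (g w) (c e) * g w y ^ e))"
    and S: "S \<subseteq> B \<union> E"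
    and ind: "\<And>p. p \<in> polys S \<Longrightarrow> (\<And>w. eval_mpoly (g w) p = 0) \<Longrightarrow> p = 0"
  shows "card S \<le> card B"
proof -
  \<comment> \<open>The target box of the rewriting: exponents up to \<open>D\<close> on
    \<open>B\<close> and up to \<open>d\<close> on \<open>E\<close>.\<close>
  define \<beta> where "\<beta> D x = (if x \<in> B then D else if x \<in> E then d else 0)" for D and x :: 'v
  \<comment> \<open>Equality under \<open>H\<close> is congruence modulo the polynomials vanishing
    at all points \<open>g w\<close>.\<close>
  define H where "H p = (\<lambda>w. eval_mpoly (g w) p)" for p
  have H_eqI: "H p = H q" if "\<And>w. eval_mpoly (g w) p = eval_mpoly (g w) q" for p q
    using that by (auto simp: H_def)
  have HD: "eval_mpoly (g w) p = eval_mpoly (g w) q" if "H p = H q" for p q w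
    using fun_cong[OF that, of w] by (simp add: H_def)

  obtain c where c: "\<And>y e. y \<in> E \<Longrightarrow> c y e \<in> polys B"
    and c_rel: "\<And>y w. y \<in> E \<Longrightarrow>
      eval_mpoly (g w) a * g w y ^ Suc d = (\<Sum>e\<le>d. eval_mpoly (g w) (c y e) * g w y ^ e)"
    using rel by metis
  have "\<exists>C. \<forall>p\<in>insert a ((\<lambda>(y, e). c y e) ` (E \<times> {..d})). exps_le (\<lambda>x. if x \<in> B then C else 0) p"
    using fin a c by (intro exps_le_finite_subset_polys) auto
  then obtain C0 where C0: "exps_le (\<lambda>x. if x \<in> B then C0 else 0) a"
    "\<And>y e. y \<in> E \<Longrightarrow> e \<le> d \<Longrightarrow> exps_le (\<lambda>x. if x \<in> B then C0 else 0) (c y e)"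
    by fastforce
  \<comment> \<open>Growth of the exponents on \<open>B\<close> in one step: \<open>C0\<close> for a
    factor \<open>a\<close> or a coefficient of a relation, and one for a new variable from
    \<open>B\<close>.\<close>
  define C where "C = Suc C0"
  have \<beta>_mult: "exps_le (\<beta> (D + C)) (p * q)"
    if "exps_le (\<lambda>x. if x \<in> B then C0 else 0) p" "exps_le (\<beta> (Suc D)) q"
    for D and p q :: "('v, 'k) mpoly"
    by (rule exps_le_mono[OF exps_le_mult[OF that]]) (auto simp: \<beta>_def C_def)
  have mult_a: "exps_le (\<beta> (D + C)) (a * p)" if "exps_le (\<beta> D) p" for D p
    by (rule \<beta>_mult[OF C0(1) exps_le_mono[OF that]]) (auto simp: \<beta>_def)

  have step_single: "\<exists>q. exps_le (\<beta> (D + C)) q \<and> H (a * Var y * Poly_Mapping.single t u) = H q"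
    if t: "\<And>x. Poly_Mapping.lookup t x \<le> \<beta> D x" and y: "y \<in> B \<union> E" for D y t u
  \<comment> \<open>Only here would an exponent on \<open>E\<close> exceed \<open>d\<close>. The
    relation then replaces \<open>a * y ^ Suc d\<close>, which uses up the factor \<open>a\<close>.
    Otherwise the product is already in the box.\<close>
  proof (cases "y \<in> E \<and> Poly_Mapping.lookup t y = d")
    case True
    define t' where "t' = t - Poly_Mapping.single y d"
    have t': "t = Poly_Mapping.single y d + t'"
      using True by (auto simp: t'_def lookup_add lookup_minus lookup_single when_def
          intro!: poly_mapping_eqI)
    define q where "q = (\<Sum>e\<le>d. c y e * Poly_Mapping.single (Poly_Mapping.single y e + t') u)"
    have "Poly_Mapping.lookup (Poly_Mapping.single y e + t') x \<le> \<beta> (Suc D) x" if "e \<le> d" for e x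
      using t[of x] that True BE
        by (auto simp: t'_def lookup_add lookup_minus lookup_single when_def \<beta>_def)
    hence "exps_le (\<beta> (D + C)) q"
      unfolding q_def using True by (intro exps_le_sum \<beta>_mult exps_le_single C0(2)) auto
    moreover have "H (a * Var y * Poly_Mapping.single t u) = H q"
    proof (rule H_eqI)
      fix w
      have "eval_mpoly (g w) (a * Var y * Poly_Mapping.single t u) =
          (eval_mpoly (g w) a * g w y ^ Suc d) * (u * eval_mon (g w) t')"
        by (simp add: t' eval_mon_add mult_ac)
      also have "\<dots> = eval_mpoly (g w) q"
        using True by (simp only: c_rel)
          (simp add: q_def sum_distrib_right sum_distrib_left eval_mon_add mult_ac)
      finally show "eval_mpoly (g w) (a * Var y * Poly_Mapping.single t u) = eval_mpoly (g w) q" .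
    qed
    ultimately show ?thesis by blast
  next
    case False
    have eq: "Var y * Poly_Mapping.single t u = Poly_Mapping.single (Poly_Mapping.single y 1 + t) u"
      by (simp add: Var_def mult_single)
    have "Poly_Mapping.lookup (Poly_Mapping.single y 1 + t) x \<le> \<beta> (Suc D) x" for x
      using t[of x] False y by (auto simp: lookup_add lookup_single when_def \<beta>_def)
    hence "exps_le (\<beta> (D + C)) (a * (Var y * Poly_Mapping.single t u))"
      unfolding eq by (intro \<beta>_mult C0(1) exps_le_single)
    thus ?thesis by (metis mult.assoc)
  qed
  have step: "\<exists>q. exps_le (\<beta> (D + C)) q \<and> H (a * Var y * p) = H q"
    if p: "exps_le (\<beta> D) p" and y: "y \<in> B \<union> E" for D y p
  proof -
    have "\<forall>t\<in>Poly_Mapping.keys p. \<exists>q. exps_le (\<beta> (D + C)) q \<and>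
        H (a * Var y * Poly_Mapping.single t (Poly_Mapping.lookup p t)) = H q"
      using p step_single[OF _ y, of _ D] by (simp add: exps_le_def)
    then obtain q where q: "\<And>t. t \<in> Poly_Mapping.keys p \<Longrightarrow> exps_le (\<beta> (D + C)) (q t) \<and>
        H (a * Var y * Poly_Mapping.single t (Poly_Mapping.lookup p t)) = H (q t)"
      by metis
    have "H (a * Var y * p) = H (\<Sum>t\<in>Poly_Mapping.keys p. q t)"
    proof (rule H_eqI)
      fix w
      have p_eq: "a * Var y * p = (\<Sum>t\<in>Poly_Mapping.keys p.
          a * Var y * Poly_Mapping.single t (Poly_Mapping.lookup p t))"
        by (subst mpoly_sum_singles[of p]) (rule sum_distrib_left)
      show "eval_mpoly (g w) (a * Var y * p) = eval_mpoly (g w) (\<Sum>t\<in>Poly_Mapping.keys p. q t)"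
        unfolding p_eq eval_mpoly_sum by (intro sum.cong refl HD) (use q in blast)
    qed
    moreover have "exps_le (\<beta> (D + C)) (\<Sum>t\<in>Poly_Mapping.keys p. q t)"
      using q by (intro exps_le_sum) auto
    ultimately show ?thesis by blast
  qed

  have finS: "finite S" using S fin by (meson finite_UnI finite_subset)
  \<comment> \<open>Each factor \<open>a\<close> absorbs one variable of \<open>t\<close>; factors
    left over once \<open>t\<close> is exhausted only raise exponents on \<open>B\<close>.\<close>
  have reduce: "\<exists>q. exps_le (\<beta> (k * C)) q \<and> H (a ^ k * Poly_Mapping.single t 1) = H q"
    if "Poly_Mapping.keys t \<subseteq> S" "(\<Sum>x\<in>S. Poly_Mapping.lookup t x) \<le> k" for k t
    using that
  proof (induction k arbitrary: t)
    case 0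
    hence "t = 0"
      using finS by (intro poly_mapping_eqI) (auto simp: in_keys_iff subset_iff)
    thus ?case by (intro exI[of _ 1]) (simp add: single_one)
  next
    case (Suc k)
    have D: "k * C + C = Suc k * C" by simp
    show ?case
    proof (cases "t = 0")
      case True
      then obtain q where q: "exps_le (\<beta> (k * C)) q" "H (a ^ k * Poly_Mapping.single 0 1) = H q"
        using Suc.IH[of 0] by auto
      have "H (a ^ Suc k * Poly_Mapping.single t 1) = H (a * q)"
        using HD[OF q(2)] True by (intro H_eqI) simp
      thus ?thesis using mult_a[OF q(1)] unfolding D by blast
    next
      case False
      then obtain y where y: "y \<in> Poly_Mapping.keys t" by (meson all_not_in_conv keys_eq_empty)
      define t' where "t' = t - Poly_Mapping.single y 1"
      have t': "t = Poly_Mapping.single y 1 + t'"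
        using y by (auto simp: t'_def lookup_add lookup_minus lookup_single when_def in_keys_iff
          intro!: poly_mapping_eqI)
      have "Poly_Mapping.keys t' \<subseteq> Poly_Mapping.keys t"
        by (auto simp: t'_def in_keys_iff lookup_minus)
      moreover have "(\<Sum>x\<in>S. Poly_Mapping.lookup t x) = Suc (\<Sum>x\<in>S. Poly_Mapping.lookup t' x)"
        using y Suc.prems(1) finS
        by (auto simp: t' lookup_add sum.distrib lookup_single when_def sum.delta)
      ultimately obtain q where q: "exps_le (\<beta> (k * C)) q"
          "H (a ^ k * Poly_Mapping.single t' 1) = H q"
        using Suc.IH[of t'] Suc.prems by auto
      obtain q' where q': "exps_le (\<beta> (k * C + C)) q'" "H (a * Var y * q) = H q'"
        using step[OF q(1), of y] y Suc.prems(1) S by blast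
      have "H (a ^ Suc k * Poly_Mapping.single t 1) = H (a * Var y * q)"
      proof (rule H_eqI)
        fix w
        have "eval_mpoly (g w) (a ^ Suc k * Poly_Mapping.single t 1) =
          eval_mpoly (g w) a * g w y * eval_mpoly (g w) (a ^ k * Poly_Mapping.single t' 1)"
          by (simp add: t' eval_mon_add mult_ac)
        thus "eval_mpoly (g w) (a ^ Suc k * Poly_Mapping.single t 1) =
            eval_mpoly (g w) (a * Var y * q)"
          unfolding HD[OF q(2)] by simp
      qed
      thus ?thesis using q' unfolding D by metis
    qed
  qed

  \<comment> \<open>Dimensions are compared among functions of \<open>w\<close>. The monomials of a
    box on \<open>S\<close>, times a power of \<open>a\<close>, are independent and lie in the span
    of the monomials of a box on \<open>B\<close> and \<open>E\<close>.\<close>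
  interpret vs: vector_space "\<lambda>(u :: 'k) (f :: 'p \<Rightarrow> 'k) w. u * f w"
    by unfold_locales (auto simp: algebra_simps)
  have "(N + 1) ^ card S \<le> (card S * N * C + 1) ^ card B * (d + 1) ^ card E" for N
  proof -
    \<comment> \<open>An upper bound for the total degree of the monomials in
      \<open>T\<close>.\<close>
    define K where "K = card S * N"
    define T where "T = {t. \<forall>x. Poly_Mapping.lookup t x \<le> (if x \<in> S then N else 0)}"
    define U where "U = {t. \<forall>x. Poly_Mapping.lookup t x \<le> \<beta> (K * C) x}"
    have T: "finite T" "card T = (N + 1) ^ card S"
      unfolding T_def using card_exponent_box[OF finS, of "\<lambda>x. if x \<in> S then N else 0"] by simp_all
    have U: "finite U" "card U = (K * C + 1) ^ card B * (d + 1) ^ card E"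
    proof -
      have "(\<Prod>x\<in>B \<union> E. \<beta> (K * C) x + 1) = (\<Prod>x\<in>B. \<beta> (K * C) x + 1) * (\<Prod>x\<in>E. \<beta> (K * C) x + 1)"
        using fin BE by (intro prod.union_disjoint) auto
      also have "(\<Prod>x\<in>E. \<beta> (K * C) x + 1) = (\<Prod>x\<in>E. d + 1)"
        using BE by (intro prod.cong) (auto simp: \<beta>_def)
      finally have "(\<Prod>x\<in>B \<union> E. \<beta> (K * C) x + 1) = (K * C + 1) ^ card B * (d + 1) ^ card E"
        by (simp add: \<beta>_def)
      thus "finite U" "card U = (K * C + 1) ^ card B * (d + 1) ^ card E"
        unfolding U_def using card_exponent_box[of "B \<union> E" "\<beta> (K * C)"] fin
        by (simp_all add: \<beta>_def)
    qed
    define v where "v t = H (a ^ K * Poly_Mapping.single t 1)" for t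
    define h where "h t = H (Poly_Mapping.single t 1)" for t
    have T_le: "Poly_Mapping.lookup t x \<le> (if x \<in> S then N else 0)" if "t \<in> T" for t x
      using that by (simp add: T_def)
    have T_keys: "Poly_Mapping.keys t \<subseteq> S" if "t \<in> T" for t
    proof (rule subsetI, rule ccontr)
      fix x assume x: "x \<in> Poly_Mapping.keys t" "x \<notin> S"
      thus False using T_le[OF that, of x] by (simp add: in_keys_iff)
    qed
    have v_span: "v t \<in> vs.span (h ` U)" if t: "t \<in> T" for t
    proof -
      have "(\<Sum>x\<in>S. Poly_Mapping.lookup t x) \<le> (\<Sum>x\<in>S. N)"
        using T_le[OF t] by (intro sum_mono) metis
      then obtain q where q: "exps_le (\<beta> (K * C)) q" "v t = H q"
        using reduce[OF T_keys[OF t], of K] by (auto simp: K_def v_def)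
      have "v t = (\<Sum>s\<in>Poly_Mapping.keys q. (\<lambda>w. Poly_Mapping.lookup q s * h s w))"
        by (simp add: q(2) H_def h_def eval_mpoly_def fun_eq_iff sum_apply)
      also have "\<dots> \<in> vs.span (h ` U)"
        using q(1) by (intro vs.span_sum vs.span_scale vs.span_base) (auto simp: U_def exps_le_def)
      finally show ?thesis .
    qed
    have v_ind: "u t = 0" if u: "(\<Sum>t\<in>T. (\<lambda>w. u t * v t w)) = 0" and t: "t \<in> T" for u t
    proof -
      define q where "q = (\<Sum>t\<in>T. Poly_Mapping.single t (u t))"
      have qS: "q \<in> polys S"
        unfolding q_def by (intro polys_sum) (use T_keys in \<open>auto simp: polys_def\<close>)
      have "eval_mpoly (g w) (a ^ K) * eval_mpoly (g w) q = 0" for w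
        using fun_cong[OF u, of w]
        by (simp add: q_def sum_apply v_def H_def sum_distrib_left mult_ac)
      \<comment> \<open>Primality cancels \<open>a ^ K\<close>, which does not vanish at
        \<open>w0\<close>.\<close>
      hence "\<forall>w. eval_mpoly (g w) q = 0"
        using prime[of "a ^ K" q] a(2) by auto
      hence "q = 0" using ind[OF qS] by blast
      hence "Poly_Mapping.lookup q t = 0" by simp
      thus "u t = 0" using t T(1) by (simp add: q_def lookup_sum lookup_single when_def)
    qed
    \<comment> \<open>\<open>vs.independent\<close> concerns the set of values of \<open>v\<close>;
      injectivity makes its cardinality that of \<open>T\<close>.\<close>
    have inj: "inj_on v T"
    proof (rule inj_onI, rule ccontr)
      fix s t assume st: "s \<in> T" "t \<in> T" "v s = v t" "s \<noteq> t"
      define u :: "_ \<Rightarrow> 'k" where "u r = (if r = s then 1 else 0) - (if r = t then 1 else 0)" for r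
      have "(\<Sum>r\<in>T. (\<lambda>w. u r * v r w)) = 0"
        using st T(1) by (auto simp: fun_eq_iff sum_apply u_def left_diff_distrib
            sum_subtractf if_distrib[of "\<lambda>c. c * _"] cong: if_cong)
      from v_ind[OF this st(1)] st(4) show False by (simp add: u_def)
    qed
    have "vs.independent (v ` T)"
    proof
      assume "vs.dependent (v ` T)"
      then obtain u f where u: "f \<in> v ` T" "u f \<noteq> 0" "(\<Sum>f\<in>v ` T. (\<lambda>w. u f * f w)) = 0"
        using T(1) by (auto simp: vs.dependent_finite)
      hence "(\<Sum>t\<in>T. (\<lambda>w. u (v t) * v t w)) = 0"
        by (simp add: sum.reindex[OF inj])
      thus False using v_ind[of "\<lambda>t. u (v t)"] u by auto
    qed
    hence "card (v ` T) \<le> card (h ` U)"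
      using vs.independent_span_bound[of "h ` U" "v ` T"] v_span U(1) by blast
    also have "\<dots> \<le> card U" by (rule card_image_le[OF U(1)])
    finally show ?thesis by (simp add: card_image[OF inj] T(2) U(2) K_def)
  qed
  thus ?thesis by (rule power_bounded_exponent_le)
qed

text \<open>Brings relations with individual leading coefficients and degrees to the uniform shape
  of \<open>independent_card_le\<close>. The product of all leading coefficients serves for every
  \<open>y\<close>, and by primality it does not vanish identically; powers of \<open>y\<close> pad
  the degrees.\<close>

lemma algebraic_independent_card_le:
  fixes g :: "'p \<Rightarrow> 'v \<Rightarrow> 'k::field"
  assumes prime: "\<And>p q. (\<And>w. eval_mpoly (g w) p * eval_mpoly (g w) q = 0) \<Longrightarrow>
      (\<forall>w. eval_mpoly (g w) p = 0) \<or> (\<forall>w. eval_mpoly (g w) q = 0)"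
    and fin: "finite B" "finite E" and BE: "B \<inter> E = {}"
    and rel: "\<And>y. y \<in> E \<Longrightarrow> \<exists>a c d. a \<in> polys B \<and> (\<exists>w. eval_mpoly (g w) a \<noteq> 0) \<and> (\<forall>e. c e \<in> polys B) \<and>
      (\<forall>w. eval_mpoly (g w) a * g w y ^ Suc d = (\<Sum>e\<le>d. eval_mpoly (g w) (c e) * g w y ^ e))"
    and S: "S \<subseteq> B \<union> E"
    and ind: "\<And>p. p \<in> polys S \<Longrightarrow> (\<And>w. eval_mpoly (g w) p = 0) \<Longrightarrow> p = 0"
  shows "card S \<le> card B"
proof -
  define P where "P y a c d \<longleftrightarrow> a \<in> polys B \<and> (\<exists>w. eval_mpoly (g w) a \<noteq> 0) \<and> (\<forall>e. c e \<in> polys B) \<and>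
      (\<forall>w. eval_mpoly (g w) a * g w y ^ Suc d = (\<Sum>e\<le>d. eval_mpoly (g w) (c e) * g w y ^ e))"
    for y and a :: "('v, 'k) mpoly" and c d
  have "\<forall>y\<in>E. \<exists>a c d. P y a c d"
    using rel unfolding P_def by blast
  then obtain a c d where "\<And>y. y \<in> E \<Longrightarrow> P y (a y) (c y) (d y)"
    by metis
  hence a: "\<And>y. y \<in> E \<Longrightarrow> a y \<in> polys B" "\<And>y. y \<in> E \<Longrightarrow> \<exists>w. eval_mpoly (g w) (a y) \<noteq> 0"
    and c: "\<And>y e. y \<in> E \<Longrightarrow> c y e \<in> polys B"
    and c_rel: "\<And>y w. y \<in> E \<Longrightarrow>
      eval_mpoly (g w) (a y) * g w y ^ Suc (d y) = (\<Sum>e\<le>d y. eval_mpoly (g w) (c y e) * g w y ^ e)"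
    unfolding P_def by blast+
  define D where "D = (\<Sum>y\<in>E. d y)"
  have dD: "d y \<le> D" if "y \<in> E" for y
    unfolding D_def using fin(2) that by (intro member_le_sum) auto
  have "\<exists>w. eval_mpoly (g w) (prod a E) \<noteq> 0"
    using fin(2) a(2)
  proof (induction E)
    case (insert y E)
    have "\<not> (\<forall>w. eval_mpoly (g w) (a y) = 0)" "\<not> (\<forall>w. eval_mpoly (g w) (prod a E) = 0)"
      using insert by auto
    hence "\<exists>w. eval_mpoly (g w) (a y) * eval_mpoly (g w) (prod a E) \<noteq> 0"
      using prime by blast
    thus ?case using insert.hyps by simp
  qed simp
  then obtain w0 where w0: "eval_mpoly (g w0) (prod a E) \<noteq> 0" ..
  show ?thesis
  proof (rule independent_card_le[OF prime fin BE _ w0 _ S ind])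
    show "prod a E \<in> polys B" using a(1) by (rule polys_prod)
    fix y assume y: "y \<in> E"
    define h where "h = prod a (E - {y})"
    have h: "h \<in> polys B" unfolding h_def using a(1) by (intro polys_prod) auto
    have prod: "prod a E = h * a y"
      unfolding h_def using fin(2) y by (simp add: prod.remove mult.commute)
    define k where "k = D - d y"
    have D: "D = d y + k" using dD[OF y] by (simp add: k_def)
    \<comment> \<open>The relation of \<open>y\<close> is multiplied by the other leading
      coefficients and by the \<open>k\<close>-th power of \<open>y\<close>, which shifts its
      coefficients by \<open>k\<close>.\<close>
    define c' where "c' e = (if k \<le> e then h * c y (e - k) else 0)" for e
    have "eval_mpoly (g w) (prod a E) * g w y ^ Suc D = (\<Sum>e\<le>D. eval_mpoly (g w) (c' e) * g w y ^ e)"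
      for w
    proof -
      have "eval_mpoly (g w) (prod a E) * g w y ^ Suc D =
          eval_mpoly (g w) h * g w y ^ k * (eval_mpoly (g w) (a y) * g w y ^ Suc (d y))"
        unfolding prod D by (simp add: power_add mult_ac)
      also have "\<dots> = (\<Sum>e\<le>d y. eval_mpoly (g w) (c' (e + k)) * g w y ^ (e + k))"
        unfolding c_rel[OF y] by (simp add: c'_def sum_distrib_left power_add mult_ac)
      also have "\<dots> = (\<Sum>e\<in>(\<lambda>e. e + k) ` {..d y}. eval_mpoly (g w) (c' e) * g w y ^ e)"
        by (subst sum.reindex) auto
      also have "\<dots> = (\<Sum>e\<le>D. eval_mpoly (g w) (c' e) * g w y ^ e)"
      proof (intro sum.mono_neutral_left ballI)
        show "(\<lambda>e. e + k) ` {..d y} \<subseteq> {..D}" by (auto simp: D)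
        fix e assume e: "e \<in> {..D} - (\<lambda>e. e + k) ` {..d y}"
        have "e < k"
        proof (rule ccontr)
          assume "\<not> e < k"
          hence "e = (e - k) + k" "e - k \<le> d y" using e by (auto simp: D)
          thus False using e by blast
        qed
        thus "eval_mpoly (g w) (c' e) * g w y ^ e = 0" by (simp add: c'_def)
      qed simp
      finally show ?thesis .
    qed
    moreover have "c' e \<in> polys B" for e
      unfolding c'_def using h c[OF y] by (auto intro: polys_mult)
    ultimately show "\<exists>c. (\<forall>e. c e \<in> polys B) \<and> (\<forall>w. eval_mpoly (g w) (prod a E) * g w y ^ Suc D =
        (\<Sum>e\<le>D. eval_mpoly (g w) (c e) * g w y ^ e))"
      by blast
  qed
qed

section \<open>Matrices of low rank and their minors\<close>

text \<open>The pair \<open>w\<close> of factors parametrizes the matrices of rank at most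
  \<open>r\<close> by an affine space, whose lines supply the curves for
  \<open>vanishing_prime\<close>. Rows and columns are numbered by all naturals; bounds enter only
  through the variables of a polynomial.\<close>

definition low_rank ::
    "nat \<Rightarrow> (nat \<Rightarrow> nat \<Rightarrow> 'k::comm_ring_1) \<times> (nat \<Rightarrow> nat \<Rightarrow> 'k) \<Rightarrow> nat \<times> nat \<Rightarrow> 'k"
  where "low_rank r w x = (\<Sum>l<r. fst w (fst x) l * snd w l (snd x))"

lemma low_rank_vanishing_prime:
  assumes inf: "infinite (UNIV :: 'k::field set)"
    and "\<And>w :: (nat \<Rightarrow> nat \<Rightarrow> 'k) \<times> (nat \<Rightarrow> nat \<Rightarrow> 'k).
      eval_mpoly (low_rank r w) p * eval_mpoly (low_rank r w) q = 0"
  shows "(\<forall>w. eval_mpoly (low_rank r w) p = 0) \<or> (\<forall>w. eval_mpoly (low_rank r w) q = 0)"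
proof (rule vanishing_prime[OF inf _ assms(2)])
  fix u w :: "(nat \<Rightarrow> nat \<Rightarrow> 'k) \<times> (nat \<Rightarrow> nat \<Rightarrow> 'k)"
  let ?L = "\<lambda>b c :: 'k. [:b, c - b:]"
  let ?\<gamma> = "\<lambda>a. (\<lambda>i l. poly (?L (fst u i l) (fst w i l)) a,
    \<lambda>l j. poly (?L (snd u l j) (snd w l j)) a)"
  let ?Q = "\<lambda>x. \<Sum>l<r. ?L (fst u (fst x) l) (fst w (fst x) l) *
      ?L (snd u l (snd x)) (snd w l (snd x))"
  show "\<exists>\<gamma> Q. \<gamma> 0 = u \<and> \<gamma> 1 = w \<and> (\<forall>a x. low_rank r (\<gamma> a) x = poly (Q x) a)"
    by (rule exI[of _ ?\<gamma>], rule exI[of _ ?Q])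
      (simp add: low_rank_def poly_sum prod_eq_iff algebra_simps)
qed

lemma mpoly_prod_eq_0_of_infinite:
  fixes p q :: "('v, 'k::field) mpoly"
  assumes inf: "infinite (UNIV :: 'k set)" and "\<And>z. eval_mpoly z p * eval_mpoly z q = 0"
  shows "p = 0 \<or> q = 0"
proof -
  have "(\<forall>z. eval_mpoly z p = 0) \<or> (\<forall>z. eval_mpoly z q = 0)"
  proof (rule vanishing_prime[OF inf _ assms(2)])
    fix u w :: "'v \<Rightarrow> 'k"
    show "\<exists>\<gamma> Q. \<gamma> 0 = u \<and> \<gamma> 1 = w \<and> (\<forall>a x. \<gamma> a x = poly (Q x) a)"
      by (rule exI[of _ "\<lambda>a x. poly [:u x, w x - u x:] a"], rule exI[of _ "\<lambda>x. [:u x, w x - u x:]"])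
        simp
  qed
  thus ?thesis using mpoly_eq_0_of_infinite[OF inf] by blast
qed

text \<open>Padding both factors with zeros to size \<open>s\<close> makes them square, and column
  \<open>r\<close> of the first one is zero because \<open>r < s\<close>.\<close>

lemma det_low_rank_eq_0:
  fixes w :: "(nat \<Rightarrow> nat \<Rightarrow> 'k::idom) \<times> (nat \<Rightarrow> nat \<Rightarrow> 'k)"
  assumes "r < s"
  shows "det (mat s s (\<lambda>(a, b). low_rank r w (f a, g b))) = 0"
proof -
  define A where "A = mat s s (\<lambda>(a, l). if l < r then fst w (f a) l else 0)"
  define B where "B = mat s s (\<lambda>(l, b). if l < r then snd w l (g b) else 0)"
  have A: "A \<in> carrier_mat s s" and B: "B \<in> carrier_mat s s" by (auto simp: A_def B_def)
  have "mat s s (\<lambda>(a, b). low_rank r w (f a, g b)) = A * B"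
  proof (rule eq_matI)
    fix a b assume "a < dim_row (A * B)" "b < dim_col (A * B)"
    hence ab: "a < s" "b < s" by (auto simp: A_def B_def)
    have "(A * B) $$ (a, b) = (\<Sum>l\<in>{0..<s}. if l < r then fst w (f a) l * snd w l (g b) else 0)"
      using ab by (auto simp: A_def B_def scalar_prod_def intro!: sum.cong)
    also have "\<dots> = (\<Sum>l<r. fst w (f a) l * snd w l (g b))"
      using assms by (intro sum.mono_neutral_cong_right) auto
    finally show "mat s s (\<lambda>(a, b). low_rank r w (f a, g b)) $$ (a, b) = (A * B) $$ (a, b)"
      using ab by (simp add: low_rank_def)
  qed (auto simp: A_def B_def)
  moreover have "det A = 0"
    using laplace_expansion_column[OF A assms] assms by (simp add: A_def)
  ultimately show ?thesis by (simp add: det_mult[OF A B])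
qed

text \<open>
  The cofactors of the last row of the \<open>s \<times> s\<close> submatrix with rows \<open>f\<close> and columns \<open>g\<close>, bordered by a
  row \<open>i\<close> and the column \<open>j\<close>, do not depend on \<open>i\<close>.
\<close>

definition border_cofactor ::
    "(nat \<Rightarrow> nat \<Rightarrow> 'a::comm_ring_1) \<Rightarrow> nat \<Rightarrow> (nat \<Rightarrow> nat) \<Rightarrow> (nat \<Rightarrow> nat) \<Rightarrow> nat \<Rightarrow> nat \<Rightarrow> 'a"
  where "border_cofactor Z s f g b j = (-1) ^ (s + b) *
    det (mat s s (\<lambda>(a, c). Z (f a) ((g(s := j)) (if c < b then c else Suc c))))"

text \<open>Laplace expansion along the bordering row; the last cofactor is the unbordered minor.
  When the bordered minor vanishes, this is a linear equation for \<open>Z i j\<close> whose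
  coefficients involve only entries in the rows \<open>f\<close> or the columns
  \<open>g\<close>.\<close>

lemma det_border:
  "det (mat (Suc s) (Suc s) (\<lambda>(a, b). Z ((f(s := i)) a) ((g(s := j)) b))) =
    Z i j * det (mat s s (\<lambda>(a, b). Z (f a) (g b))) +
        (\<Sum>b<s. Z i (g b) * border_cofactor Z s f g b j)"
proof -
  define A where "A = mat (Suc s) (Suc s) (\<lambda>(a, b). Z ((f(s := i)) a) ((g(s := j)) b))"
  have "mat_delete A s b = mat s s (\<lambda>(a, c). Z (f a) ((g(s := j)) (if c < b then c else Suc c)))"
    if "b < s" for b
    using that by (intro eq_matI) (auto simp: A_def mat_delete_def)
  hence cof: "cofactor A s b = border_cofactor Z s f g b j" if "b < s" for b
    using that by (simp add: cofactor_def border_cofactor_def)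
  have last: "mat_delete A s s = mat s s (\<lambda>(a, b). Z (f a) (g b))"
    by (intro eq_matI) (auto simp: A_def mat_delete_def)
  have "det A = (\<Sum>b<Suc s. A $$ (s, b) * cofactor A s b)"
    by (rule laplace_expansion_row) (auto simp: A_def)
  also have "\<dots> = A $$ (s, s) * cofactor A s s + (\<Sum>b<s. A $$ (s, b) * cofactor A s b)"
    by simp
  also have "(\<Sum>b<s. A $$ (s, b) * cofactor A s b) = (\<Sum>b<s. Z i (g b) * border_cofactor Z s f g b j)"
    by (intro sum.cong) (auto simp: cof, auto simp: A_def)
  also have "A $$ (s, s) * cofactor A s s = Z i j * det (mat s s (\<lambda>(a, b). Z (f a) (g b)))"
    by (simp add: cofactor_def last) (simp add: A_def)
  finally show ?thesis by (simp only: A_def)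
qed

section \<open>Minors given by maps instead of sets of rows and columns\<close>

lemma det_rows_pick:
  fixes F :: "nat \<Rightarrow> nat \<Rightarrow> 'a::comm_ring_1"
  assumes inj: "inj_on f {..<s}"
  shows "\<exists>c\<in>{1, -1}. det (mat s s (\<lambda>(a, b). F (f a) b)) =
    c * det (mat s s (\<lambda>(a, b). F (pick (f ` {..<s}) a) b))"
proof -
  define I where "I = f ` {..<s}"
  \<comment> \<open>The position of \<open>f a\<close> in the increasing enumeration of
    \<open>I\<close>, extended by the identity as \<open>permutes\<close> requires. Sorting the rows
    costs only the sign of this permutation.\<close>
  define \<pi> where "\<pi> a = (if a < s then card {x\<in>I. x < f a} else a)" for a
  have "card I = s" using inj by (simp add: I_def card_image)
  have pick: "pick I (\<pi> a) = f a" if "a < s" for a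
    using that by (simp add: \<pi>_def I_def pick_card_in_set)
  have lt: "\<pi> a < s" if "a < s" for a
  proof -
    have "{x\<in>I. x < f a} \<subset> I" using that by (auto simp: I_def)
    hence "card {x\<in>I. x < f a} < card I" by (intro psubset_card_mono) (auto simp: I_def)
    thus ?thesis using that \<open>card I = s\<close> by (simp add: \<pi>_def)
  qed
  have "inj_on \<pi> {0..<s}"
    using inj pick by (metis atLeastLessThan_iff inj_on_def lessThan_iff)
  moreover have "\<pi> ` {0..<s} \<subseteq> {0..<s}" using lt by auto
  ultimately have "bij_betw \<pi> {0..<s} {0..<s}"
    by (simp add: bij_betw_def endo_inj_surj)
  hence perm: "\<pi> permutes {0..<s}"
    by (rule bij_imp_permutes) (simp add: \<pi>_def)
  let ?A = "mat s s (\<lambda>(a, b). F (pick I a) b)"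
  have "mat s s (\<lambda>(a, b). F (f a) b) = mat s s (\<lambda>(a, b). ?A $$ (\<pi> a, b))"
    by (rule eq_matI) (auto simp: lt pick)
  hence "det (mat s s (\<lambda>(a, b). F (f a) b)) = signof \<pi> * det ?A"
    using det_permute_rows[OF _ perm, of ?A] by simp
  thus ?thesis by (auto simp: I_def sign_def)
qed

lemma minors_generic_matE:
  assumes "\<delta> \<in> minors s (generic_mat m n :: (nat \<times> nat, 'k::comm_ring_1) mpoly mat)"
  obtains f g where "\<And>a. a < s \<Longrightarrow> f a < m" "\<And>b. b < s \<Longrightarrow> g b < n"
    "\<delta> = det (mat s s (\<lambda>(a, b). Var (f a, g b)))"
proof -
  obtain I J where IJ: "I \<subseteq> {..<m}" "J \<subseteq> {..<n}" "card I = s" "card J = s"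
    and \<delta>: "\<delta> = det (submatrix (generic_mat m n :: (nat \<times> nat, 'k) mpoly mat) I J)"
    using assms by (auto simp: minors_def generic_mat_def)
  have I: "{i. i < m \<and> i \<in> I} = I" and J: "{j. j < n \<and> j \<in> J} = J" using IJ by auto
  have "pick I a < m" if "a < s" for a
    using pick_in_set_le[of a I] that IJ by auto
  moreover have "pick J b < n" if "b < s" for b
    using pick_in_set_le[of b J] that IJ by auto
  ultimately show ?thesis
    by (intro that[of "pick I" "pick J"])
      (auto simp: \<delta> submatrix_def generic_mat_def I J IJ intro!: arg_cong[of _ _ det] eq_matI)
qed

text \<open>Sorting the rows and then, in the transposed matrix, the columns costs one sign
  each.\<close>

lemma minorsI:
  assumes f: "inj_on f {..<s}" "\<And>a. a < s \<Longrightarrow> f a < m"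
    and g: "inj_on g {..<s}" "\<And>b. b < s \<Longrightarrow> g b < n"
  shows "\<exists>c\<in>{1, -1}. \<exists>\<delta>\<in>minors s (generic_mat m n :: (nat \<times> nat, 'k::comm_ring_1) mpoly mat).
    det (mat s s (\<lambda>(a, b). Var (f a, g b))) = c * \<delta>"
proof -
  let ?I = "f ` {..<s}" and ?J = "g ` {..<s}"
  obtain c where c: "c \<in> {1, -1}" "det (mat s s (\<lambda>(a, b). Var (f a, g b) :: (nat \<times> nat, 'k) mpoly)) =
      c * det (mat s s (\<lambda>(a, b). Var (pick ?I a, g b)))"
    using det_rows_pick[OF f(1), of "\<lambda>i b. Var (i, g b)"] by blast
  obtain d where d: "d \<in> {1, -1}" "det (mat s s (\<lambda>(b, a). Var (pick ?I a, g b) :: (nat \<times> nat, 'k) mpoly)) =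
      d * det (mat s s (\<lambda>(b, a). Var (pick ?I a, pick ?J b)))"
    using det_rows_pick[OF g(1), of "\<lambda>j a. Var (pick ?I a, j)"] by blast
  have tr: "det (mat s s (\<lambda>(a, b). Var (pick ?I a, h b))) =
      det (mat s s (\<lambda>(b, a). Var (pick ?I a, h b) :: (nat \<times> nat, 'k) mpoly))" for h
    by (subst det_transpose[symmetric]) (auto intro!: arg_cong[of _ _ det] eq_matI)
  have I: "{i. i < m \<and> i \<in> ?I} = ?I" and J: "{j. j < n \<and> j \<in> ?J} = ?J" using f g by auto
  have card: "card ?I = s" "card ?J = s" using f g by (simp_all add: card_image)
  have "pick ?I a < m" if "a < s" for a
    using pick_in_set_le[of a ?I] that I card by auto
  moreover have "pick ?J b < n" if "b < s" for b
    using pick_in_set_le[of b ?J] that J card by auto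
  ultimately have "submatrix (generic_mat m n) ?I ?J =
      mat s s (\<lambda>(a, b). Var (pick ?I a, pick ?J b) :: (nat \<times> nat, 'k) mpoly)"
    by (intro eq_matI) (auto simp: submatrix_def generic_mat_def I J card)
  hence sub: "det (mat s s (\<lambda>(a, b). Var (pick ?I a, pick ?J b) :: (nat \<times> nat, 'k) mpoly)) =
      det (submatrix (generic_mat m n) ?I ?J)" by simp
  have "det (mat s s (\<lambda>(a, b). Var (pick ?I a, pick ?J b) :: (nat \<times> nat, 'k) mpoly)) \<in>
      minors s (generic_mat m n)"
    unfolding minors_def
    by (rule CollectI, rule exI[of _ ?I], rule exI[of _ ?J])
      (use f g card sub in \<open>auto simp: generic_mat_def\<close>)
  moreover have "det (mat s s (\<lambda>(a, b). Var (f a, g b) :: (nat \<times> nat, 'k) mpoly)) =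
      c * d * det (mat s s (\<lambda>(a, b). Var (pick ?I a, pick ?J b)))"
    using c(2) d(2) by (simp add: tr mult.assoc)
  moreover have "c * d \<in> {1, -1}" using c(1) d(1) by auto
  ultimately show ?thesis by blast
qed

lemma det_not_inj_eq_0:
  fixes F :: "nat \<Rightarrow> nat \<Rightarrow> 'a::comm_ring_1"
  assumes "\<not> inj_on f {..<s} \<or> \<not> inj_on g {..<s}"
  shows "det (mat s s (\<lambda>(a, b). F (f a) (g b))) = 0"
  using assms
proof
  assume "\<not> inj_on f {..<s}"
  then obtain a b where "a < s" "b < s" "a \<noteq> b" "f a = f b" by (auto simp: inj_on_def)
  thus ?thesis
    by (intro det_identical_rows[of _ s a b]) (auto intro!: eq_vecI)
next
  assume "\<not> inj_on g {..<s}"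
  then obtain a b where "a < s" "b < s" "a \<noteq> b" "g a = g b" by (auto simp: inj_on_def)
  thus ?thesis
    by (intro det_identical_columns[of _ s a b]) (auto intro!: eq_vecI)
qed

section \<open>Ideals of the polynomial ring\<close>

lemma poly_ring_simps [simp]:
  "carrier (poly_ring V) = polys V" "x \<otimes>\<^bsub>poly_ring V\<^esub> y = x * y" "x \<oplus>\<^bsub>poly_ring V\<^esub> y = x + y"
  "\<one>\<^bsub>poly_ring V\<^esub> = 1" "\<zero>\<^bsub>poly_ring V\<^esub> = 0"
  by (simp_all add: poly_ring_def)

lemma cring_poly_ring: "cring (poly_ring V :: ('v, 'k::comm_ring_1) mpoly ring)"
proof (rule cringI)
  show "abelian_group (poly_ring V :: ('v, 'k) mpoly ring)"
    by (rule abelian_groupI)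
      (auto simp: algebra_simps intro: polys_add polys_uminus bexI[of _ "- x" for x])
  show "comm_monoid (poly_ring V :: ('v, 'k) mpoly ring)"
    by (rule comm_monoidI) (auto simp: algebra_simps intro: polys_mult)
qed (auto simp: algebra_simps)

lemma poly_ring_idealI:
  fixes I :: "('v, 'k::comm_ring_1) mpoly set"
  assumes "I \<subseteq> polys V" "0 \<in> I" "\<And>p q. p \<in> I \<Longrightarrow> q \<in> I \<Longrightarrow> p + q \<in> I"
    "\<And>p q. p \<in> polys V \<Longrightarrow> q \<in> I \<Longrightarrow> p * q \<in> I"
  shows "ideal I (poly_ring V)"
proof -
  interpret cring "poly_ring V :: ('v, 'k) mpoly ring" by (rule cring_poly_ring)
  have uminus: "- p \<in> I" if "p \<in> I" for p
    using assms(4)[of "- 1" p] that by (simp add: polys_uminus)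
  have inv: "\<ominus>\<^bsub>poly_ring V\<^esub> p = - p" if "p \<in> I" for p
    using that assms(1) polys_uminus[of p V] by (intro minus_equality) auto
  have "subgroup I (add_monoid (poly_ring V))"
  proof (rule add.subgroupI)
    show "I \<subseteq> carrier (poly_ring V)" using assms(1) by simp
    show "I \<noteq> {}" using assms(2) by auto
    show "\<ominus>\<^bsub>poly_ring V\<^esub> p \<in> I" if "p \<in> I" for p using that inv uminus by simp
    show "p \<oplus>\<^bsub>poly_ring V\<^esub> q \<in> I" if "p \<in> I" "q \<in> I" for p q using that assms(3) by simp
  qed
  moreover have "q * p \<in> I" if "p \<in> polys V" "q \<in> I" for p q
    using assms(4)[OF that] by (simp add: mult.commute)
  ultimately show ?thesis
    by (intro idealI[OF ring_axioms]) (use assms(4) in auto)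
qed

context
  fixes I :: "('v, 'k::comm_ring_1) mpoly set" and V
  assumes I: "ideal I (poly_ring V)"
begin

interpretation ideal I "poly_ring V" by (rule I)

lemma poly_ideal_0: "0 \<in> I"
  using additive_subgroup.zero_closed[OF additive_subgroup_axioms] by simp

lemma poly_ideal_add: "p \<in> I \<Longrightarrow> q \<in> I \<Longrightarrow> p + q \<in> I"
  using additive_subgroup.a_closed[OF additive_subgroup_axioms] by simp

lemma poly_ideal_mult: "p \<in> polys V \<Longrightarrow> q \<in> I \<Longrightarrow> p * q \<in> I"
  using I_l_closed by simp

lemma poly_ideal_sum: "(\<And>a. a \<in> A \<Longrightarrow> f a \<in> I) \<Longrightarrow> sum f A \<in> I"
  by (induction A rule: infinite_finite_induct) (auto intro: poly_ideal_0 poly_ideal_add)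

lemma poly_ideal_mult_cong:
  assumes "p - p' \<in> I" "q - q' \<in> I" "p \<in> polys V" "q' \<in> polys V"
  shows "p * q - p' * q' \<in> I"
proof -
  have "p * q - p' * q' = p * (q - q') + q' * (p - p')" by (simp add: algebra_simps)
  thus ?thesis using assms by (auto intro: poly_ideal_add poly_ideal_mult)
qed

lemma poly_ideal_prod_cong:
  assumes "\<And>a. a \<in> A \<Longrightarrow> f a - g a \<in> I" "\<And>a. a \<in> A \<Longrightarrow> f a \<in> polys V" "\<And>a. a \<in> A \<Longrightarrow> g a \<in> polys V"
  shows "prod f A - prod g A \<in> I"
  using assms
  by (induction A rule: infinite_finite_induct)
    (auto intro!: poly_ideal_0 poly_ideal_mult_cong polys_prod)

lemma poly_ideal_power_cong:
  assumes "p - q \<in> I" "p \<in> polys V" "q \<in> polys V"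
  shows "p ^ n - q ^ n \<in> I"
  using poly_ideal_prod_cong[of "{..<n}" "\<lambda>_. p" "\<lambda>_. q"] assms by simp

text \<open>This is the radical of the colon ideal of \<open>p\<close>. Sums stay inside because
  each term of \<open>(q + q') ^ (e + e')\<close> contains \<open>q ^ e\<close> or
  \<open>q' ^ e'\<close>. Being an ideal, it contains a generated ideal once it contains the
  generators.\<close>

lemma ideal_radical_colon: "ideal {q \<in> polys V. \<exists>e. q ^ e * p \<in> I} (poly_ring V)"
proof (rule poly_ring_idealI)
  show "0 \<in> {q \<in> polys V. \<exists>e. q ^ e * p \<in> I}"
    using poly_ideal_0 by (auto intro!: exI[of _ 1])
next
  fix q q' assume "q \<in> {q \<in> polys V. \<exists>e. q ^ e * p \<in> I}" "q' \<in> {q \<in> polys V. \<exists>e. q ^ e * p \<in> I}"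
  then obtain e e' where q: "q \<in> polys V" "q' \<in> polys V" and e: "q ^ e * p \<in> I" "q' ^ e' * p \<in> I"
    by auto
  have "of_nat c * q ^ k * q' ^ (e + e' - k) * p \<in> I" for c k
  proof (cases "e \<le> k")
    case True
    hence "q ^ k = q ^ (k - e) * q ^ e" by (simp add: power_add[symmetric])
    hence "of_nat c * q ^ k * q' ^ (e + e' - k) * p =
        (of_nat c * q ^ (k - e) * q' ^ (e + e' - k)) * (q ^ e * p)"
      by (simp add: mult_ac)
    moreover have "of_nat c * q ^ (k - e) * q' ^ (e + e' - k) \<in> polys V"
      using q by (intro polys_mult polys_power) (auto intro: polys_of_nat)
    ultimately show ?thesis using e(1) poly_ideal_mult by metis
  next
    case False
    hence "q' ^ (e + e' - k) = q' ^ (e - k) * q' ^ e'" by (simp add: power_add[symmetric])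
    hence "of_nat c * q ^ k * q' ^ (e + e' - k) * p =
        (of_nat c * q ^ k * q' ^ (e - k)) * (q' ^ e' * p)"
      by (simp add: mult_ac)
    moreover have "of_nat c * q ^ k * q' ^ (e - k) \<in> polys V"
      using q by (intro polys_mult polys_power) (auto intro: polys_of_nat)
    ultimately show ?thesis using e(2) poly_ideal_mult by metis
  qed
  hence "(q + q') ^ (e + e') * p \<in> I"
    by (simp add: binomial_ring sum_distrib_right poly_ideal_sum)
  thus "q + q' \<in> {q \<in> polys V. \<exists>e. q ^ e * p \<in> I}" using q polys_add by blast
next
  fix u q :: "('v, 'k) mpoly" assume u: "u \<in> polys V" and "q \<in> {q \<in> polys V. \<exists>e. q ^ e * p \<in> I}"
  then obtain e where q: "q \<in> polys V" "q ^ e * p \<in> I" by auto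
  have "(u * q) ^ e * p = u ^ e * (q ^ e * p)" by (simp add: power_mult_distrib mult_ac)
  hence "(u * q) ^ e * p \<in> I" using u q poly_ideal_mult polys_power by metis
  thus "u * q \<in> {q \<in> polys V. \<exists>e. q ^ e * p \<in> I}" using u q polys_mult by blast
qed auto

text \<open>The quotient map is a ring homomorphism, so it commutes with the sums and products in
  \<open>eval_alg\<close>. Together with \<open>coset_eq_zero_iff\<close> this turns independence in
  the quotient into a question of membership in \<open>I\<close>.\<close>

lemma eval_alg_quotient:
  assumes "p \<in> polys V"
  shows "eval_alg (poly_ring V Quot I) (\<lambda>c. I +>\<^bsub>poly_ring V\<^esub> Const c) (\<lambda>x. I +>\<^bsub>poly_ring V\<^esub> Var x) p =
    I +>\<^bsub>poly_ring V\<^esub> p"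
proof -
  interpret ring_hom_cring "poly_ring V" "poly_ring V Quot I" "(+>\<^bsub>poly_ring V\<^esub>) I"
    by (rule rcos_ring_hom_cring[OF cring_poly_ring])
  let ?S = "poly_ring V Quot I" and ?h = "(+>\<^bsub>poly_ring V\<^esub>) I"
  have h_closed: "?h q \<in> carrier ?S" if "q \<in> polys V" for q
    using hom_closed that by simp
  have pow: "?h q [^]\<^bsub>?S\<^esub> (n::nat) = ?h (q ^ n)" if "q \<in> polys V" for q n
    using that hom_one hom_mult[of "q ^ _" q] polys_power[OF that]
    by (induction n) (simp_all add: power_Suc2 del: power_Suc)
  have prod: "(\<Otimes>\<^bsub>?S\<^esub>x\<in>A. ?h (f x)) = ?h (prod f A)"
    if "finite A" "\<And>x. x \<in> A \<Longrightarrow> f x \<in> polys V" for f and A :: "'v set"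
    using that
  proof (induction A)
    case (insert a A)
    have "?h (f a * prod f A) = ?h (f a) \<otimes>\<^bsub>?S\<^esub> ?h (prod f A)"
      using hom_mult[of "f a" "prod f A"] insert.prems polys_prod[of A f] by simp
    thus ?case
      using insert by (subst S.finprod_insert) (auto intro!: h_closed)
  qed (use hom_one in simp)
  have sum: "(\<Oplus>\<^bsub>?S\<^esub>x\<in>A. ?h (f x)) = ?h (sum f A)"
    if "finite A" "\<And>x. x \<in> A \<Longrightarrow> f x \<in> polys V" for f and A :: "('v \<Rightarrow>\<^sub>0 nat) set"
    using that
  proof (induction A)
    case (insert a A)
    have "?h (f a + sum f A) = ?h (f a) \<oplus>\<^bsub>?S\<^esub> ?h (sum f A)"
      using hom_add[of "f a" "sum f A"] insert.prems polys_sum[of A f] by simp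
    thus ?case
      using insert by (subst S.finsum_insert) (auto intro!: h_closed)
  qed (use hom_zero in simp)
  define mon :: "('v \<Rightarrow>\<^sub>0 nat) \<Rightarrow> ('v, 'k) mpoly"
    where "mon t = (\<Prod>x\<in>Poly_Mapping.keys t. Var x ^ Poly_Mapping.lookup t x)" for t
  have Var: "(Var x :: ('v, 'k) mpoly) \<in> polys V"
    if "t \<in> Poly_Mapping.keys p" "x \<in> Poly_Mapping.keys t" for t x
    unfolding polys_Var using that assms by (auto simp: polys_def)
  have mon_polys: "mon t \<in> polys V" if "t \<in> Poly_Mapping.keys p" for t
    unfolding mon_def using Var[OF that] by (intro polys_prod polys_power)
  have "?h (Const (Poly_Mapping.lookup p t)) \<otimes>\<^bsub>?S\<^esub>
      (\<Otimes>\<^bsub>?S\<^esub>x\<in>Poly_Mapping.keys t. ?h (Var x) [^]\<^bsub>?S\<^esub> Poly_Mapping.lookup t x) =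
      ?h (Const (Poly_Mapping.lookup p t) * mon t)" if t: "t \<in> Poly_Mapping.keys p" for t
  proof -
    have "(\<Otimes>\<^bsub>?S\<^esub>x\<in>Poly_Mapping.keys t. ?h (Var x) [^]\<^bsub>?S\<^esub> Poly_Mapping.lookup t x) =
        (\<Otimes>\<^bsub>?S\<^esub>x\<in>Poly_Mapping.keys t. ?h (Var x ^ Poly_Mapping.lookup t x))"
      using Var[OF t] by (intro S.finprod_cong') (auto intro!: h_closed polys_power simp: pow)
    also have "\<dots> = ?h (mon t)"
      unfolding mon_def using Var[OF t] by (intro prod polys_power) auto
    finally show ?thesis
      using hom_mult[of "Const (Poly_Mapping.lookup p t)" "mon t"] mon_polys[OF t] by simp
  qed
  hence "eval_alg ?S (\<lambda>c. ?h (Const c)) (\<lambda>x. ?h (Var x)) p =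
      (\<Oplus>\<^bsub>?S\<^esub>t\<in>Poly_Mapping.keys p. ?h (Const (Poly_Mapping.lookup p t) * mon t))"
    unfolding eval_alg_def
    by (intro S.finsum_cong') (auto intro!: h_closed polys_mult mon_polys)
  also have "\<dots> = ?h (\<Sum>t\<in>Poly_Mapping.keys p. Const (Poly_Mapping.lookup p t) * mon t)"
    by (intro sum polys_mult mon_polys) auto
  also have "(\<Sum>t\<in>Poly_Mapping.keys p. Const (Poly_Mapping.lookup p t) * mon t) = p"
    unfolding mon_def single_eq_Const_prod[symmetric] by (rule mpoly_sum_singles[symmetric])
  finally show ?thesis .
qed

lemma coset_eq_zero_iff:
  assumes "p \<in> polys V"
  shows "I +>\<^bsub>poly_ring V\<^esub> p = \<zero>\<^bsub>poly_ring V Quot I\<^esub> \<longleftrightarrow> p \<in> I"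
  using assms rcos_const_imp_mem[of p] ring.a_rcos_zero[OF cring.axioms(1)[OF cring_poly_ring] I, of p]
  by (auto simp: FactRing_def)

end

section \<open>The ideals of minors\<close>

text \<open>The size \<open>s\<close> is free for the induction in
  \<open>vanishing_power_mem_minor_ideal\<close>; \<open>det_ideal r m n\<close> is the case
  \<open>Suc r\<close>.\<close>

definition minor_ideal :: "nat \<Rightarrow> nat \<Rightarrow> nat \<Rightarrow> (nat \<times> nat, 'k::comm_ring_1) mpoly set"
  where "minor_ideal s m n = Idl\<^bsub>poly_ring (ground m n)\<^esub> (minors s (generic_mat m n))"

lemma minors_subset_polys:
  "minors s (generic_mat m n :: (nat \<times> nat, 'k::comm_ring_1) mpoly mat) \<subseteq> polys (ground m n)"
proof
  fix \<delta> :: "(nat \<times> nat, 'k) mpoly" assume "\<delta> \<in> minors s (generic_mat m n)"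
  thus "\<delta> \<in> polys (ground m n)"
    by (rule minors_generic_matE) (auto intro!: polys_det simp: ground_def)
qed

lemma ideal_minor_ideal:
  "ideal (minor_ideal s m n :: (nat \<times> nat, 'k::comm_ring_1) mpoly set) (poly_ring (ground m n))"
proof -
  interpret cring "poly_ring (ground m n) :: (nat \<times> nat, 'k) mpoly ring" by (rule cring_poly_ring)
  show ?thesis
    unfolding minor_ideal_def by (rule genideal_ideal) (simp add: minors_subset_polys)
qed

lemma minors_subset_minor_ideal:
  "minors s (generic_mat m n :: (nat \<times> nat, 'k::comm_ring_1) mpoly mat) \<subseteq> minor_ideal s m n"
proof -
  interpret cring "poly_ring (ground m n) :: (nat \<times> nat, 'k) mpoly ring" by (rule cring_poly_ring)
  show ?thesis
    unfolding minor_ideal_def by (rule genideal_self) (simp add: minors_subset_polys)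
qed

lemma minor_ideal_minimal:
  fixes Q :: "(nat \<times> nat, 'k::comm_ring_1) mpoly set"
  assumes "ideal Q (poly_ring (ground m n))" "minors s (generic_mat m n) \<subseteq> Q"
  shows "minor_ideal s m n \<subseteq> Q"
proof -
  interpret cring "poly_ring (ground m n) :: (nat \<times> nat, 'k) mpoly ring" by (rule cring_poly_ring)
  show ?thesis
    unfolding minor_ideal_def by (rule genideal_minimal[OF assms])
qed

text \<open>The maps need not be injective, since a repeated row or column makes the determinant 0.
  Bordering by a row or column already chosen is thus no special case.\<close>

lemma det_mem_minor_ideal:
  assumes "\<And>a. a < s \<Longrightarrow> f a < m" "\<And>b. b < s \<Longrightarrow> g b < n"
  shows "det (mat s s (\<lambda>(a, b). Var (f a, g b))) \<in>
      (minor_ideal s m n :: (nat \<times> nat, 'k::comm_ring_1) mpoly set)"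
proof (cases "inj_on f {..<s} \<and> inj_on g {..<s}")
  case True
  then obtain c \<delta> where c: "c \<in> {1, -1}" and \<delta>: "\<delta> \<in> minors s (generic_mat m n)"
    and "det (mat s s (\<lambda>(a, b). Var (f a, g b) :: (nat \<times> nat, 'k) mpoly)) = c * \<delta>"
    using minorsI[of f s m g n] assms by metis
  moreover have "c \<in> polys (ground m n)" using c by (auto intro: polys_uminus)
  ultimately show ?thesis
    using poly_ideal_mult[OF ideal_minor_ideal] minors_subset_minor_ideal by fastforce
next
  case False
  thus ?thesis
    using det_not_inj_eq_0[of f s g "\<lambda>i j. Var (i, j) :: (nat \<times> nat, 'k) mpoly"]
      poly_ideal_0[OF ideal_minor_ideal] by auto
qed

lemma eval_mpoly_det:
  "eval_mpoly z (det (mat s s (\<lambda>(a, b). F a b))) = det (mat s s (\<lambda>(a, b). eval_mpoly z (F a b)))"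
proof -
  interpret comm_ring_hom "eval_mpoly z" by (rule comm_ring_hom_eval_mpoly)
  have "map_mat (eval_mpoly z) (mat s s (\<lambda>(a, b). F a b)) = mat s s (\<lambda>(a, b). eval_mpoly z (F a b))"
    by (rule eq_matI) auto
  thus ?thesis by (metis hom_det)
qed

text \<open>The polynomials vanishing at one low rank matrix form an ideal, so it suffices to check
  the generators.\<close>

lemma minor_ideal_vanishes:
  fixes p :: "(nat \<times> nat, 'k::idom) mpoly"
  assumes "p \<in> minor_ideal (Suc r) m n"
  shows "eval_mpoly (low_rank r w) p = 0"
proof -
  have "ideal {p \<in> polys (ground m n). eval_mpoly (low_rank r w) p = 0} (poly_ring (ground m n))"
    by (rule poly_ring_idealI) (auto intro: polys_add polys_mult)
  moreover have "eval_mpoly (low_rank r w) \<delta> = 0"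
    if "\<delta> \<in> minors (Suc r) (generic_mat m n)" for \<delta> :: "(nat \<times> nat, 'k) mpoly"
    using that
    by (rule minors_generic_matE) (simp add: eval_mpoly_det det_low_rank_eq_0)
  ultimately show ?thesis
    using minor_ideal_minimal[of _ m n "Suc r"] minors_subset_polys assms by blast
qed

section \<open>Powers of vanishing polynomials in the ideal of minors\<close>

text \<open>
  Expanding a bordered minor along its last row shows that, modulo the minors of size \<open>s + 1\<close>, the
  generic matrix times an \<open>s \<times> s\<close> minor \<open>\<delta>\<close> is a product of an \<open>m \<times> s\<close> and an \<open>s \<times> n\<close> matrix.
  Hence \<open>\<delta> ^ D * p\<close> is congruent to the homogenization of \<open>p\<close> at a matrix of rank at most \<open>s\<close>, which
  vanishes wherever \<open>\<delta>\<close> does not.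
\<close>

lemma minor_power_mult_mem:
  fixes p :: "(nat \<times> nat, 'k::field) mpoly"
  assumes inf: "infinite (UNIV :: 'k set)"
    and p: "p \<in> polys (ground m n)" "\<And>w. eval_mpoly (low_rank r w) p = 0"
    and s: "s \<le> r" and \<delta>: "\<delta> \<in> minors s (generic_mat m n)"
  shows "\<exists>e. \<delta> ^ e * p \<in> minor_ideal (Suc s) m n"
proof -
  let ?V = "ground m n" and ?I = "minor_ideal (Suc s) m n :: (nat \<times> nat, 'k) mpoly set"
  note I = ideal_minor_ideal[where 'k = 'k]
  obtain f g where f: "\<And>a. a < s \<Longrightarrow> f a < m" and g: "\<And>b. b < s \<Longrightarrow> g b < n"
    and \<delta>_eq: "\<delta> = det (mat s s (\<lambda>(a, b). Var (f a, g b)))"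
    using minors_generic_matE[OF \<delta>] by metis
  have \<delta>_polys: "\<delta> \<in> polys ?V" using \<delta> minors_subset_polys by blast
  define cof :: "nat \<Rightarrow> nat \<Rightarrow> (nat \<times> nat, 'k) mpoly"
    where "cof = border_cofactor (\<lambda>i j. Var (i, j)) s f g"
  \<comment> \<open>Congruent to \<open>\<delta> * Var x\<close> modulo the ideal. Where
    \<open>\<delta>\<close> does not vanish, it is \<open>\<delta>\<close> times an entry of a
    product with inner dimension \<open>s\<close>.\<close>
  define W where "W x = - (\<Sum>b<s. Var (fst x, g b) * cof b (snd x))" for x
  have cof: "cof b j \<in> polys ?V" if "j < n" for b j
    unfolding cof_def border_cofactor_def using f g that
    by (intro polys_mult polys_power polys_uminus polys_det) (auto simp: ground_def)
  have W_polys: "W x \<in> polys ?V" if "x \<in> ?V" for x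
    unfolding W_def using that g
    by (intro polys_uminus polys_sum polys_mult cof) (auto simp: ground_def)
  have W_cong: "\<delta> * Var x - W x \<in> ?I" if x_ground: "x \<in> ?V" for x
  proof -
    obtain i j where x: "x = (i, j)" "i < m" "j < n" using x_ground by (auto simp: ground_def)
    have "det (mat (Suc s) (Suc s) (\<lambda>(a, b). Var ((f(s := i)) a, (g(s := j)) b))) \<in> ?I"
      using x f g by (intro det_mem_minor_ideal) (auto simp: less_Suc_eq)
    also have "det (mat (Suc s) (Suc s) (\<lambda>(a, b). Var ((f(s := i)) a, (g(s := j)) b))) =
        Var (i, j) * \<delta> + (\<Sum>b<s. Var (i, g b) * cof b j)"
      unfolding \<delta>_eq cof_def by (rule det_border)
    finally show ?thesis
      by (simp add: x W_def mult.commute)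
  qed
  define deg where "deg t = (\<Sum>x\<in>Poly_Mapping.keys t. Poly_Mapping.lookup t x)"
    for t :: "nat \<times> nat \<Rightarrow>\<^sub>0 nat"
  define D where "D = (\<Sum>t\<in>Poly_Mapping.keys p. deg t)"
  have deg: "deg t \<le> D" if "t \<in> Poly_Mapping.keys p" for t
    unfolding D_def using that by (intro member_le_sum) auto
  define mon where "mon F t = (\<Prod>x\<in>Poly_Mapping.keys t. F x ^ Poly_Mapping.lookup t x)"
    for F :: "nat \<times> nat \<Rightarrow> (nat \<times> nat, 'k) mpoly" and t
  \<comment> \<open>Homogenization of \<open>p\<close> in degree \<open>D\<close>, with
    \<open>\<delta>\<close> as homogenizing variable, taken at \<open>F\<close>.\<close>
  define R where "R F = (\<Sum>t\<in>Poly_Mapping.keys p. Const (Poly_Mapping.lookup p t) * \<delta> ^ (D - deg t) * mon F t)"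
    for F
  have mon_scale: "mon (\<lambda>x. \<delta> * Var x) t = \<delta> ^ deg t * mon Var t" for t
    by (simp add: mon_def deg_def power_mult_distrib prod.distrib power_sum)
  have "R (\<lambda>x. \<delta> * Var x) =
      (\<Sum>t\<in>Poly_Mapping.keys p. \<delta> ^ D * (Const (Poly_Mapping.lookup p t) * mon Var t))"
    unfolding R_def mon_scale
  proof (rule sum.cong)
    fix t assume "t \<in> Poly_Mapping.keys p"
    hence "\<delta> ^ D = \<delta> ^ (D - deg t) * \<delta> ^ deg t"
      using deg by (simp add: power_add[symmetric])
    thus "Const (Poly_Mapping.lookup p t) * \<delta> ^ (D - deg t) * (\<delta> ^ deg t * mon Var t) =
        \<delta> ^ D * (Const (Poly_Mapping.lookup p t) * mon Var t)"
      by (simp add: mult_ac)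
  qed simp
  also have "\<dots> = \<delta> ^ D * p"
    unfolding mon_def single_eq_Const_prod[symmetric] sum_distrib_left[symmetric]
    by (simp add: mpoly_sum_singles[symmetric])
  finally have R1: "R (\<lambda>x. \<delta> * Var x) = \<delta> ^ D * p" .
  have keys: "x \<in> ?V" if "t \<in> Poly_Mapping.keys p" "x \<in> Poly_Mapping.keys t" for t x
    using that p(1) by (auto simp: polys_def)
  have R2: "R (\<lambda>x. \<delta> * Var x) - R W \<in> ?I"
    unfolding R_def sum_subtractf[symmetric] right_diff_distrib[symmetric]
  proof (intro poly_ideal_sum[OF I] poly_ideal_mult[OF I])
    fix t assume t: "t \<in> Poly_Mapping.keys p"
    show "Const (Poly_Mapping.lookup p t) * \<delta> ^ (D - deg t) \<in> polys ?V"
      using \<delta>_polys by (intro polys_mult polys_power) auto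
    show "mon (\<lambda>x. \<delta> * Var x) t - mon W t \<in> ?I"
      unfolding mon_def using keys[OF t] \<delta>_polys
      by (intro poly_ideal_prod_cong[OF I] poly_ideal_power_cong[OF I] polys_power polys_mult W_cong W_polys)
        auto
  qed
  \<comment> \<open>The extra factor settles the points where \<open>\<delta>\<close> vanishes, so
    the product is zero at every point.\<close>
  have "\<delta> * R W = 0"
  proof (rule mpoly_eq_0_of_infinite[OF inf])
    fix z :: "nat \<times> nat \<Rightarrow> 'k"
    define d where "d = eval_mpoly z \<delta>"
    \<comment> \<open>Zero columns fill this factor up from \<open>s\<close> to the inner dimension
      \<open>r\<close>.\<close>
    define X where "X i l = (if l < s then - z (i, g l) / d else 0)" for i l
    define y where "y = low_rank r (X, \<lambda>l j. eval_mpoly z (cof l j))"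
    show "eval_mpoly z (\<delta> * R W) = 0"
    proof (cases "d = 0")
      case False
      have y: "eval_mpoly z (W x) = d * y x" for x
      proof -
        have "y x = (\<Sum>l<s. - z (fst x, g l) / d * eval_mpoly z (cof l (snd x)))"
          unfolding y_def low_rank_def X_def using s by (intro sum.mono_neutral_cong_right) auto
        thus ?thesis using False by (simp add: W_def sum_distrib_left sum_negf)
      qed
      have "eval_mpoly z (mon W t) = d ^ deg t * eval_mon y t" for t
        using eval_mon_scale[of d y t] by (simp add: mon_def y deg_def eval_mon_def)
      hence "eval_mpoly z (R W) = (\<Sum>t\<in>Poly_Mapping.keys p.
          Poly_Mapping.lookup p t * d ^ (D - deg t) * (d ^ deg t * eval_mon y t))"
        by (simp add: R_def d_def)
      also have "\<dots> = (\<Sum>t\<in>Poly_Mapping.keys p. d ^ D * (Poly_Mapping.lookup p t * eval_mon y t))"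
      proof (rule sum.cong)
        fix t assume "t \<in> Poly_Mapping.keys p"
        hence "d ^ D = d ^ (D - deg t) * d ^ deg t"
          using deg by (simp add: power_add[symmetric])
        thus "Poly_Mapping.lookup p t * d ^ (D - deg t) * (d ^ deg t * eval_mon y t) =
            d ^ D * (Poly_Mapping.lookup p t * eval_mon y t)" by (simp add: mult_ac)
      qed simp
      also have "\<dots> = d ^ D * eval_mpoly y p"
        by (simp add: eval_mpoly_def sum_distrib_left)
      also have "\<dots> = 0" by (simp add: y_def p(2))
      finally show ?thesis by simp
    qed (simp add: d_def)
  qed
  hence "\<delta> ^ Suc D * p = \<delta> * (R (\<lambda>x. \<delta> * Var x) - R W)"
    by (simp add: R1 right_diff_distrib mult_ac)
  thus ?thesis using poly_ideal_mult[OF I \<delta>_polys R2] by metis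
qed

text \<open>Induction on the size of the minors, starting from the empty minor 1. The radical of the
  colon ideal of \<open>p\<close> for size \<open>s + 1\<close> contains the ideal for size
  \<open>s\<close>, hence a power of \<open>p\<close>; so a higher power of \<open>p\<close> lies in
  the ideal for size \<open>s + 1\<close>.\<close>

lemma vanishing_power_mem_minor_ideal:
  fixes p :: "(nat \<times> nat, 'k::field) mpoly"
  assumes inf: "infinite (UNIV :: 'k set)"
    and p: "p \<in> polys (ground m n)" "\<And>w. eval_mpoly (low_rank r w) p = 0"
    and "s \<le> Suc r"
  shows "\<exists>N. p ^ N \<in> minor_ideal s m n"
  using assms(4)
proof (induction s)
  case 0
  have "1 \<in> minors 0 (generic_mat m n :: (nat \<times> nat, 'k) mpoly mat)"
    unfolding minors_def
    by (rule CollectI, rule exI[of _ "{}"], rule exI[of _ "{}"]) (simp add: submatrix_def)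
  thus ?case using minors_subset_minor_ideal by (intro exI[of _ 0]) auto
next
  case (Suc s)
  let ?Q = "{q \<in> polys (ground m n). \<exists>e. q ^ e * p \<in> minor_ideal (Suc s) m n}"
  have "minors s (generic_mat m n) \<subseteq> ?Q"
    using minor_power_mult_mem[OF inf p, of s] Suc.prems minors_subset_polys by fastforce
  with ideal_radical_colon[OF ideal_minor_ideal] have "minor_ideal s m n \<subseteq> ?Q"
    by (rule minor_ideal_minimal)
  moreover obtain N where "p ^ N \<in> minor_ideal s m n" using Suc by auto
  ultimately obtain e where "(p ^ N) ^ e * p \<in> minor_ideal (Suc s) m n" by blast
  hence "p ^ (N * e + 1) \<in> minor_ideal (Suc s) m n"
    by (simp add: power_mult mult.commute)
  thus ?case ..
qed

text \<open>Radicality is avoided as follows: the power of \<open>p\<close> that lies in the ideal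
  is again a polynomial in the variables of \<open>\<Omega>\<close>, so independence makes it zero,
  and then \<open>p\<close> is zero.\<close>

lemma matroid_indep_iff:
  assumes inf: "infinite (UNIV :: 'k::field set)"
  shows "matroid_indep TYPE('k) r m n \<Omega> \<longleftrightarrow> \<Omega> \<subseteq> ground m n \<and>
    (\<forall>p \<in> polys \<Omega>. (\<forall>w. eval_mpoly (low_rank r w) (p :: (nat \<times> nat, 'k) mpoly) = 0) \<longrightarrow> p = 0)"
proof (cases "\<Omega> \<subseteq> ground m n")
  case True
  hence sub: "p \<in> polys (ground m n)" if "p \<in> polys \<Omega>" for p :: "(nat \<times> nat, 'k) mpoly"
    using that polys_mono by blast
  let ?I = "minor_ideal (Suc r) m n :: (nat \<times> nat, 'k) mpoly set"
  have det_ideal: "(det_ideal r m n :: (nat \<times> nat, 'k) mpoly set) = ?I"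
    by (simp add: det_ideal_def minor_ideal_def)
  have "matroid_indep TYPE('k) r m n \<Omega> \<longleftrightarrow> (\<forall>p \<in> polys \<Omega>. p \<in> ?I \<longrightarrow> p = 0)"
    using True
    by (auto simp: matroid_indep_def algebraically_independent_def coord_ring_def residue_class_def
        det_ideal eval_alg_quotient[OF ideal_minor_ideal sub]
          coset_eq_zero_iff[OF ideal_minor_ideal sub])
  also have "\<dots> \<longleftrightarrow>
      (\<forall>p \<in> polys \<Omega>. (\<forall>w. eval_mpoly (low_rank r w) (p :: (nat \<times> nat, 'k) mpoly) = 0) \<longrightarrow> p = 0)"
  proof (intro iffI ballI impI)
    fix p :: "(nat \<times> nat, 'k) mpoly"
    assume ind: "\<forall>p\<in>polys \<Omega>. p \<in> ?I \<longrightarrow> p = 0" and p: "p \<in> polys \<Omega>"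
      and van: "\<forall>w. eval_mpoly (low_rank r w) p = 0"
    obtain N where "p ^ N \<in> ?I"
      using vanishing_power_mem_minor_ideal[OF inf sub[OF p], of r "Suc r"] van by auto
    hence "p ^ N = 0" using ind polys_power[OF p] by blast
    hence "eval_mpoly z p ^ N = 0" for z using eval_mpoly_power[of z p N] by simp
    thus "p = 0" by (intro mpoly_eq_0_of_infinite[OF inf]) (simp add: power_eq_0_iff)
  qed (use minor_ideal_vanishes in blast)
  finally show ?thesis using True by simp
qed (simp add: matroid_indep_def)

section \<open>Independent sets of entries of a low rank matrix\<close>

text \<open>No matrix size appears, so arbitrary rectangles \<open>I \<times> J\<close> and an
  unbounded hook are covered too.\<close>

definition low_rank_indep :: "'k::field itself \<Rightarrow> nat \<Rightarrow> (nat \<times> nat) set \<Rightarrow> bool"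
  where "low_rank_indep K r \<Omega> \<longleftrightarrow> (\<forall>p \<in> polys \<Omega>.
    (\<forall>w. eval_mpoly (low_rank r w) (p :: (nat \<times> nat, 'k) mpoly) = 0) \<longrightarrow> p = 0)"

lemma low_rank_indep_mono: "low_rank_indep K r \<Omega> \<Longrightarrow> S \<subseteq> \<Omega> \<Longrightarrow> low_rank_indep K r S"
  unfolding low_rank_indep_def using polys_mono by blast

text \<open>\<open>B\<close> consists of the entries in \<open>r\<close> chosen rows
  \<open>I0\<close> or \<open>r\<close> chosen columns \<open>J0\<close>. Every other entry
  satisfies a linear relation over \<open>B\<close>, a vanishing bordered minor, with the
  \<open>I0 \<times> J0\<close> minor as leading coefficient.\<close>

lemma low_rank_indep_card_le:
  fixes S :: "(nat \<times> nat) set"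
  assumes inf: "infinite (UNIV :: 'k::field set)"
    and fin: "finite I" "finite J" and rI: "r \<le> card I" and rJ: "r \<le> card J"
    and S: "S \<subseteq> I \<times> J" and ind: "low_rank_indep TYPE('k) r S"
  shows "card S \<le> r * (card I + card J - r)"
proof -
  obtain I0 where I0: "I0 \<subseteq> I" "card I0 = r" using obtain_subset_with_card_n[OF rI] by blast
  obtain J0 where J0: "J0 \<subseteq> J" "card J0 = r" using obtain_subset_with_card_n[OF rJ] by blast
  have fin0: "finite I0" "finite J0" using I0 J0 fin finite_subset by auto
  obtain f where f: "bij_betw f {0..<r} I0" using ex_bij_betw_nat_finite[OF fin0(1)] I0 by auto
  obtain g where g: "bij_betw g {0..<r} J0" using ex_bij_betw_nat_finite[OF fin0(2)] J0 by auto
  have fI: "f a \<in> I0" if "a < r" for a using f that by (auto simp: bij_betw_def)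
  have gJ: "g b \<in> J0" if "b < r" for b using g that by (auto simp: bij_betw_def)
  define B where "B = {x \<in> I \<times> J. fst x \<in> I0 \<or> snd x \<in> J0}"
  define E where "E = (I - I0) \<times> (J - J0)"
  define a where "a = det (mat r r (\<lambda>(a, b). Var (f a, g b) :: (nat \<times> nat, 'k) mpoly))"
  have union: "I \<times> J = B \<union> E" by (auto simp: B_def E_def)
  have finBE: "finite B" "finite E" using fin by (auto simp: B_def E_def)
  have disj: "B \<inter> E = {}" by (auto simp: B_def E_def)
  have a: "a \<in> polys B"
    unfolding a_def using fI gJ I0 J0 by (intro polys_det) (auto simp: B_def)
  \<comment> \<open>At this point the \<open>I0 \<times> J0\<close> block is the identity, so the
    leading coefficient does not vanish identically.\<close>
  define w0 :: "(nat \<Rightarrow> nat \<Rightarrow> 'k) \<times> (nat \<Rightarrow> nat \<Rightarrow> 'k)"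
    where "w0 = (\<lambda>i l. if i = f l then 1 else 0, \<lambda>l j. if j = g l then 1 else 0)"
  have "mat r r (\<lambda>(a, b). low_rank r w0 (f a, g b)) = 1\<^sub>m r"
  proof (rule eq_matI)
    fix a b assume "a < dim_row (1\<^sub>m r :: 'k mat)" "b < dim_col (1\<^sub>m r :: 'k mat)"
    hence ab: "a < r" "b < r" by auto
    have "low_rank r w0 (f a, g b) = (\<Sum>l<r. if l = a then (if a = b then 1 else 0) else 0)"
    proof -
      have "f a = f l \<longleftrightarrow> l = a" "g b = g l \<longleftrightarrow> l = b" if "l < r" for l
        using that ab f g by (auto simp: bij_betw_def inj_on_eq_iff)
      thus ?thesis unfolding low_rank_def w0_def by (intro sum.cong refl) auto
    qed
    thus "mat r r (\<lambda>(a, b). low_rank r w0 (f a, g b)) $$ (a, b) = 1\<^sub>m r $$ (a, b)"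
      using ab by simp
  qed auto
  hence w0: "eval_mpoly (low_rank r w0) a \<noteq> 0"
    by (simp add: a_def eval_mpoly_det)
  have "card S \<le> card B"
  proof (rule algebraic_independent_card_le[OF low_rank_vanishing_prime[OF inf] finBE disj])
    fix y assume "y \<in> E"
    then obtain i j where y: "y = (i, j)" "i \<in> I" "j \<in> J" by (auto simp: E_def)
    define c where "c =
        - (\<Sum>b<r. Var (i, g b) * border_cofactor (\<lambda>i j. Var (i, j) :: (nat \<times> nat, 'k) mpoly) r f g b j)"
    have "c \<in> polys B"
      unfolding c_def border_cofactor_def using y fI gJ I0 J0
      by (intro polys_uminus polys_sum polys_mult polys_power polys_det) (auto simp: B_def)
    moreover have "eval_mpoly (low_rank r w) a * low_rank r w y = eval_mpoly (low_rank r w) c" for w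
    proof -
      have "det (mat (Suc r) (Suc r) (\<lambda>(a, b). Var ((f(r := i)) a, (g(r := j)) b) :: (nat \<times> nat, 'k) mpoly)) =
          Var (i, j) * a - c"
        unfolding c_def a_def using det_border[of r "\<lambda>i j. Var (i, j)" f i g j] by simp
      moreover have "eval_mpoly (low_rank r w)
          (det (mat (Suc r) (Suc r) (\<lambda>(a, b). Var ((f(r := i)) a, (g(r := j)) b)))) = 0"
        unfolding eval_mpoly_det eval_mpoly_Var by (rule det_low_rank_eq_0) simp
      ultimately show ?thesis by (simp add: y mult.commute)
    qed
    ultimately show "\<exists>(a :: (nat \<times> nat, 'k) mpoly) c d. a \<in> polys B \<and> (\<exists>w. eval_mpoly (low_rank r w) a \<noteq> 0) \<and>
        (\<forall>e. c e \<in> polys B) \<and>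
        (\<forall>w. eval_mpoly (low_rank r w) a * low_rank r w y ^ Suc d =
          (\<Sum>e\<le>d. eval_mpoly (low_rank r w) (c e) * low_rank r w y ^ e))"
      using a w0 by (intro exI[of _ a] exI[of _ "\<lambda>_. c"] exI[of _ 0])
        (auto simp del: split_paired_Ex split_paired_All)
  qed (use S union ind in \<open>auto simp: low_rank_indep_def\<close>)
  also have "card B = r * (card I + card J - r)"
  proof -
    have "card (I \<times> J) = card B + card E"
      unfolding union using finBE disj by (rule card_Un_disjoint)
    moreover have "card E = (card I - r) * (card J - r)"
      using I0 J0 fin0 by (simp add: E_def card_cartesian_product card_Diff_subset)
    moreover obtain u v where "card I = u + r" "card J = v + r"
      using rI rJ by (metis le_add_diff_inverse2)
    ultimately show ?thesis by (simp add: card_cartesian_product algebra_simps)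
  qed
  finally show ?thesis .
qed

text \<open>
  A matrix whose top left \<open>r \<times> r\<close> block is invertible can be changed outside the first \<open>r\<close> rows and
  columns into a matrix of rank \<open>r\<close>.
\<close>

lemma low_rank_indep_hook:
  assumes inf: "infinite (UNIV :: 'k::field set)"
  shows "low_rank_indep TYPE('k) r {x. fst x < r \<or> snd x < r}"
  unfolding low_rank_indep_def
proof (intro ballI impI)
  fix p :: "(nat \<times> nat, 'k) mpoly"
  assume p: "p \<in> polys {x. fst x < r \<or> snd x < r}" and van: "\<forall>w. eval_mpoly (low_rank r w) p = 0"
  define \<delta> where "\<delta> = det (mat r r (\<lambda>(a, b). Var (a, b) :: (nat \<times> nat, 'k) mpoly))"
  have eval_\<delta>: "eval_mpoly z \<delta> = det (mat r r (\<lambda>(a, b). z (a, b)))" for z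
    unfolding \<delta>_def eval_mpoly_det eval_mpoly_Var ..
  have "eval_mpoly z \<delta> * eval_mpoly z p = 0" for z
  proof (cases "eval_mpoly z \<delta> = 0")
    case False
    define A where "A = mat r r (\<lambda>(a, b). z (a, b))"
    have A: "A \<in> carrier_mat r r" by (simp add: A_def)
    define d where "d = det A"
    have d: "d \<noteq> 0" using False by (simp only: eval_\<delta> d_def A_def not_False_eq_True)
    note adj = adj_mat[OF A]
    have AB: "(\<Sum>l<r. z (i, l) * adj_mat A $$ (l, k)) = (if i = k then d else 0)"
      if "i < r" "k < r" for i k
    proof -
      have "(\<Sum>l<r. z (i, l) * adj_mat A $$ (l, k)) = (A * adj_mat A) $$ (i, k)"
        using that adj(1) A by (auto simp: scalar_prod_def A_def lessThan_atLeast0 intro!: sum.cong)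
      also have "(A * adj_mat A) $$ (i, k) = (if i = k then d else 0)"
        unfolding adj(2) using that by (simp add: d_def)
      finally show ?thesis .
    qed
    have BA: "(\<Sum>k<r. adj_mat A $$ (l, k) * z (k, j)) = (if l = j then d else 0)"
      if "l < r" "j < r" for l j
    proof -
      have "(\<Sum>k<r. adj_mat A $$ (l, k) * z (k, j)) = (adj_mat A * A) $$ (l, j)"
        using that adj(1) A by (auto simp: scalar_prod_def A_def lessThan_atLeast0 intro!: sum.cong)
      also have "(adj_mat A * A) $$ (l, j) = (if l = j then d else 0)"
        unfolding adj(3) using that by (simp add: d_def)
      finally show ?thesis .
    qed
    \<comment> \<open>The first factor is the first \<open>r\<close> columns of \<open>z\<close>;
      the second is the inverse of \<open>A\<close>, as adjugate over determinant, times the first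
      \<open>r\<close> rows.\<close>
    define w where "w = (\<lambda>i l. z (i, l), \<lambda>l j. (\<Sum>k<r. adj_mat A $$ (l, k) * z (k, j)) / d)"
    have "low_rank r w x = z x" if x: "fst x < r \<or> snd x < r" for x
    proof (cases "snd x < r")
      case True
      have "low_rank r w x = (\<Sum>l<r. if l = snd x then z (fst x, l) else 0)"
        unfolding low_rank_def w_def using True d by (intro sum.cong) (auto simp: BA)
      thus ?thesis using True by simp
    next
      case False
      hence i: "fst x < r" using x by simp
      have "low_rank r w x = (\<Sum>l<r. \<Sum>k<r. z (fst x, l) * adj_mat A $$ (l, k) * z (k, snd x)) / d"
        by (simp add: low_rank_def w_def sum_distrib_left sum_divide_distrib mult_ac)
      also have "(\<Sum>l<r. \<Sum>k<r. z (fst x, l) * adj_mat A $$ (l, k) * z (k, snd x)) =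
          (\<Sum>k<r. (\<Sum>l<r. z (fst x, l) * adj_mat A $$ (l, k)) * z (k, snd x))"
        by (subst sum.swap) (simp add: sum_distrib_right)
      also have "\<dots> = (\<Sum>k<r. if k = fst x then d * z (k, snd x) else 0)"
        using i by (intro sum.cong) (auto simp: AB)
      also have "\<dots> / d = z x" using i d by simp
      finally show ?thesis .
    qed
    hence "eval_mpoly z p = eval_mpoly (low_rank r w) p"
      by (intro eval_mpoly_cong[OF p]) auto
    thus ?thesis using van by simp
  qed simp
  hence "\<delta> = 0 \<or> p = 0" by (rule mpoly_prod_eq_0_of_infinite[OF inf])
  \<comment> \<open>The identity pattern excludes \<open>\<delta> = 0\<close>.\<close>
  moreover have "eval_mpoly (\<lambda>x. if fst x = snd x then 1 else 0) \<delta> = 1"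
  proof -
    have "mat r r (\<lambda>(a, b). if a = b then 1 else 0 :: 'k) = 1\<^sub>m r" by (rule eq_matI) auto
    thus ?thesis by (simp add: eval_\<delta>)
  qed
  ultimately show "p = 0" by auto
qed

text \<open>By maximality each outside \<open>x\<close> is a variable of some nonzero vanishing
  polynomial. Its leading coefficient in \<open>x\<close> is a nonzero polynomial over the
  independent set \<open>\<Omega>\<close>, so it does not vanish identically, and \<open>x\<close>
  is algebraic over \<open>\<Omega>\<close>.\<close>

lemma card_le_of_maximal_low_rank_indep:
  assumes inf: "infinite (UNIV :: 'k::field set)"
    and fin: "finite G" and \<Omega>: "\<Omega> \<subseteq> G" "low_rank_indep TYPE('k) r \<Omega>"
    and max: "\<And>x. x \<in> G - \<Omega> \<Longrightarrow> \<not> low_rank_indep TYPE('k) r (insert x \<Omega>)"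
    and S: "S \<subseteq> G" "low_rank_indep TYPE('k) r S"
  shows "card S \<le> card \<Omega>"
proof (rule algebraic_independent_card_le[OF low_rank_vanishing_prime[OF inf]])
  show "finite \<Omega>" "finite (G - \<Omega>)" "\<Omega> \<inter> (G - \<Omega>) = {}" "S \<subseteq> \<Omega> \<union> (G - \<Omega>)"
    using fin \<Omega> S finite_subset by auto
  show "p = 0"
    if "p \<in> polys S" "\<And>w. eval_mpoly (low_rank r w) p = 0" for p :: "(nat \<times> nat, 'k) mpoly"
    using that S by (auto simp: low_rank_indep_def)
  fix x assume "x \<in> G - \<Omega>"
  then obtain p :: "(nat \<times> nat, 'k) mpoly" where p: "p \<in> polys (insert x \<Omega>)" "p \<noteq> 0"
    and van: "\<And>w. eval_mpoly (low_rank r w) p = 0"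
    using max[of x] by (auto simp: low_rank_indep_def)
  obtain q D where q: "\<And>e. q e \<in> polys \<Omega>" "q D \<noteq> 0" and p_eq: "p = (\<Sum>e\<le>D. q e * Var x ^ e)"
    using polys_insert_expansion[OF p] by blast
  have nonvan: "\<exists>w. eval_mpoly (low_rank r w) (q D) \<noteq> 0"
    using \<Omega>(2) q unfolding low_rank_indep_def by blast
  \<comment> \<open>For \<open>D = 0\<close> the vanishing \<open>p\<close> would equal its own
    leading coefficient.\<close>
  have "D \<noteq> 0"
  proof
    assume "D = 0"
    thus False using van nonvan p_eq by auto
  qed
  then obtain d where d: "D = Suc d" by (cases D) auto
  have rel: "eval_mpoly (low_rank r w) (q D) * low_rank r w x ^ Suc d =
      (\<Sum>e\<le>d. eval_mpoly (low_rank r w) (- q e) * low_rank r w x ^ e)" for w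
    using van[of w] by (simp add: p_eq d sum_negf eq_neg_iff_add_eq_0 add.commute)
  show "\<exists>(a :: (nat \<times> nat, 'k) mpoly) c d. a \<in> polys \<Omega> \<and> (\<exists>w. eval_mpoly (low_rank r w) a \<noteq> 0) \<and>
      (\<forall>e. c e \<in> polys \<Omega>) \<and>
      (\<forall>w. eval_mpoly (low_rank r w) a * low_rank r w x ^ Suc d =
        (\<Sum>e\<le>d. eval_mpoly (low_rank r w) (c e) * low_rank r w x ^ e))"
    by (intro exI[of _ "q D"] exI[of _ "\<lambda>e. - q e"] exI[of _ d])
      (use rel q(1) nonvan polys_uminus in blast)
qed

section \<open>From cardinality bounds to the column inequalities\<close>

lemma card_Omega:
  assumes "finite J" "\<And>j. j \<in> J \<Longrightarrow> finite (\<omega> j)"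
  shows "card (Omega \<omega> J) = (\<Sum>j\<in>J. card (\<omega> j))"
proof -
  have "card (Omega \<omega> J) = (\<Sum>j\<in>J. card (\<omega> j \<times> {j}))"
    unfolding Omega_def using assms by (intro card_UN_disjoint) auto
  thus ?thesis by (simp add: card_cartesian_product)
qed

text \<open>Only the columns in \<open>K\<close> contribute. If there are at least \<open>r\<close>
  of them, the bound for \<open>I \<times> K\<close> applies, and subtracting
  \<open>r * card K\<close> leaves \<open>r * (card I - r)\<close>. Otherwise fewer than
  \<open>r\<close> columns contribute at most \<open>card I - r\<close> each.\<close>

lemma column_excess_le:
  assumes inf: "infinite (UNIV :: 'k::field set)"
    and fin: "finite I" "finite J" and r: "r \<le> card I"
    and ind: "low_rank_indep TYPE('k) r (Omega \<omega> J)"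
  shows "(\<Sum>j\<in>J. max (int (card (\<omega> j \<inter> I)) - int r) 0) \<le> int r * (int (card I) - int r)"
proof -
  define K where "K = {j \<in> J. r \<le> card (\<omega> j \<inter> I)}"
  have K: "finite K" "K \<subseteq> J" using fin by (auto simp: K_def)
  have "(\<Sum>j\<in>J. max (int (card (\<omega> j \<inter> I)) - int r) 0) = (\<Sum>j\<in>K. int (card (\<omega> j \<inter> I)) - int r)"
    using fin by (intro sum.mono_neutral_cong_right) (auto simp: K_def)
  also have "\<dots> \<le> int r * (int (card I) - int r)"
  proof (cases "r \<le> card K")
    case True
    let ?S = "Omega (\<lambda>j. \<omega> j \<inter> I) K"
    have "?S \<subseteq> Omega \<omega> J" using K by (auto simp: Omega_def)
    hence "low_rank_indep TYPE('k) r ?S" using ind low_rank_indep_mono by blast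
    hence "card ?S \<le> r * (card I + card K - r)"
      using fin K r True by (intro low_rank_indep_card_le[OF inf]) (auto simp: Omega_def)
    hence "int (card ?S) \<le> int r * (int (card I) + int (card K) - int r)"
      using r by
        (metis (mono_tags, lifting) of_nat_add of_nat_diff of_nat_le_iff of_nat_mult trans_le_add1)
    moreover have "card ?S = (\<Sum>j\<in>K. card (\<omega> j \<inter> I))"
      using fin K by (intro card_Omega) auto
    ultimately show ?thesis
      by (simp add: sum_subtractf algebra_simps)
  next
    case False
    have "(\<Sum>j\<in>K. int (card (\<omega> j \<inter> I)) - int r) \<le> (\<Sum>j\<in>K. int (card I) - int r)"
      using fin by (intro sum_mono) (auto intro: card_mono)
    also have "\<dots> = int (card K) * (int (card I) - int r)" by simp
    also have "\<dots> \<le> int r * (int (card I) - int r)"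
      using False r by (intro mult_right_mono) auto
    finally show ?thesis .
  qed
  finally show ?thesis .
qed

theorem proposition1:
  fixes r m n :: nat and \<omega> :: "nat \<Rightarrow> nat set"
  assumes "infinite (UNIV :: 'k::field set)"
    and "0 < r" and "r < m" and "m \<le> n"
    and "\<And>j. j < n \<Longrightarrow> \<omega> j \<subseteq> {..<m}"
    and "matroid_base TYPE('k) r m n (Omega \<omega> {..<n})"
  shows "relaxed_SLMF r r m \<omega> {..<n}"
proof -
  note inf = assms(1)
  let ?\<Omega> = "Omega \<omega> {..<n}"
  have indep_iff: "matroid_indep TYPE('k) r m n S \<longleftrightarrow> S \<subseteq> ground m n \<and> low_rank_indep TYPE('k) r S"
    for S
    by (simp add: matroid_indep_iff[OF inf] low_rank_indep_def)
  have \<Omega>: "?\<Omega> \<subseteq> ground m n" "low_rank_indep TYPE('k) r ?\<Omega>"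
    using assms(6) by (auto simp: matroid_base_def indep_iff)
  have max: "\<not> low_rank_indep TYPE('k) r (insert x ?\<Omega>)" if "x \<in> ground m n - ?\<Omega>" for x
    using assms(6) that unfolding matroid_base_def indep_iff by blast
  have le: "(\<Sum>j<n. max (int (card (\<omega> j \<inter> I)) - int r) 0) \<le> int r * (int (card I) - int r)"
    if "I \<subseteq> {..<m}" "r + 1 \<le> card I" for I
    using that finite_subset[OF that(1)] by (intro column_excess_le[OF inf _ _ _ \<Omega>(2)]) auto
  \<comment> \<open>A base is at least as large as the hook \<open>H\<close>, which has
    \<open>r * (m + n - r)\<close> elements; subtracting \<open>r\<close> for each of the
    \<open>n\<close> columns leaves \<open>r * (m - r)\<close>.\<close>
  have "int r * (int m - int r) \<le> (\<Sum>j<n. max (int (card (\<omega> j \<inter> {..<m})) - int r) 0)"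
  proof -
    define H where "H = {x \<in> ground m n. fst x < r \<or> snd x < r}"
    have "low_rank_indep TYPE('k) r H"
      by (rule low_rank_indep_mono[OF low_rank_indep_hook[OF inf]]) (auto simp: H_def)
    hence "card H \<le> card ?\<Omega>"
      by (intro card_le_of_maximal_low_rank_indep[OF inf _ \<Omega> max]) (auto simp: H_def ground_def)
    also have "card ?\<Omega> = (\<Sum>j<n. card (\<omega> j))"
      using assms(5) finite_subset by (intro card_Omega) blast+
    finally have "int (card H) \<le> (\<Sum>j<n. int (card (\<omega> j)))"
      by (simp only: of_nat_sum[symmetric] of_nat_le_iff)
    moreover have "int (card H) = int r * (int m + int n - int r)"
    proof -
      have "ground m n = H \<union> {r..<m} \<times> {r..<n}" by (auto simp: H_def ground_def)
      moreover have "card (H \<union> {r..<m} \<times> {r..<n}) = card H + card ({r..<m} \<times> {r..<n})"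
        by (rule card_Un_disjoint) (auto simp: H_def ground_def)
      ultimately have "card (ground m n) = card H + (m - r) * (n - r)"
        by (simp add: card_cartesian_product)
      moreover have "card (ground m n) = m * n"
        by (simp add: ground_def card_cartesian_product)
      moreover obtain u v where "m = u + r" "n = v + r"
        using assms(3,4) by (metis le_add_diff_inverse2 le_trans less_imp_le)
      ultimately show ?thesis by (simp add: algebra_simps)
    qed
    \<comment> \<open>Dropping the maximum with 0 can only lower the sum.\<close>
    moreover have "(\<Sum>j<n. int (card (\<omega> j)) - int r) \<le>
        (\<Sum>j<n. max (int (card (\<omega> j \<inter> {..<m})) - int r) 0)"
      using assms(5) by (intro sum_mono) (auto simp: Int_absorb2)
    ultimately show ?thesis by (simp add: sum_subtractf algebra_simps)
  qed
  with le[of "{..<m}"] le assms(2,3) show ?thesis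
    by (auto simp: relaxed_SLMF_def)
qed

end
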